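(* Let $\Sigma$ be an alphabet and let $\varepsilon>0$ be such that $|\Sigma|^2/\varepsilon=O(n)$. Any $R$-pass deterministic algorithm in the asymmetric streaming model that computes a $(1+\varepsilon)$-approximation of $\mathsf{LCS}(x,y)$ for two strings $x,y\in\Sigma^n$ must use space $\Omega\!\left(\frac{|\Sigma|}{\varepsilon}/R\right)$.
   Context: $\mathsf{LCS}(x,y)$ is the length of a longest common subsequence of $x$ and $y$. A $(1+\varepsilon)$-approximation means outputting a value $\lambda$ with $\mathsf{LCS}(x,y)\le\lambda\le(1+\varepsilon)\mathsf{LCS}(x,y)$. In the asymmetric streaming model, the algorithm has streaming access to $x$ (reading it left to right, once per pass; $R$ passes) and random access to $y$; space is the working memory of the algorithm.
   Formalization: The alphabet is required to have at least two letters: for |Σ| = 1 the LCS is always n, so an algorithm that outputs the constant n needs no space, and the claimed bound fails (e.g. ε = 1/n). *)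

theory Defs
  imports Complex_Main "HOL-Library.Sublist"
begin

definition words :: "'a set \<Rightarrow> nat \<Rightarrow> 'a list set" where
  "words \<Sigma> n = {x. set x \<subseteq> \<Sigma> \<and> length x = n}"

definition LCS :: "'a list \<Rightarrow> 'a list \<Rightarrow> nat" where
  "LCS x y = Max {length z | z. subseq z x \<and> subseq z y}"

definition is_LCS_approx :: "real \<Rightarrow> 'a list \<Rightarrow> 'a list \<Rightarrow> real \<Rightarrow> bool" where
  "is_LCS_approx \<epsilon> x y v \<longleftrightarrow> real (LCS x y) \<le> v \<and> v \<le> (1 + \<epsilon>) * real (LCS x y)"

text \<open>
  A deterministic asymmetric streaming algorithm. Its working memory holds a finite bit string,
  and this string alone (there is no clock, pass counter or control state besides it) determines
  the next action: read the next symbol of the streamed string \<open>x\<close> (\<open>None\<close> signals the end of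
  \<open>x\<close>), query a position of \<open>y\<close> (\<open>None\<close> if it is out of range), rewind \<open>x\<close> and start a new
  pass, or halt with an output. The function arguments give the new contents of the memory in
  terms of the symbol obtained. Algorithms are non-uniform: the transition function is arbitrary
  and may be chosen depending on the alphabet, the input length and the accuracy.
\<close>

datatype 'a action =
    Read "'a option \<Rightarrow> bool list"
  | Query nat "'a option \<Rightarrow> bool list"
  | New_Pass "bool list"
  | Output real

record 'a asym_alg =
  init_mem :: "bool list"
  act :: "bool list \<Rightarrow> 'a action"

definition symbol_at :: "'a list \<Rightarrow> nat \<Rightarrow> 'a option" where
  "symbol_at w i = (if i < length w then Some (w ! i) else None)"

text \<open>
  Configurations consist of the memory contents, the number of the current pass and the position
  of the reading head on \<open>x\<close>; the algorithm has no access to the last two components.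
  Halting configurations are fixed points of the step function.
\<close>

type_synonym config = "bool list \<times> nat \<times> nat"

fun asym_step :: "'a asym_alg \<Rightarrow> 'a list \<Rightarrow> 'a list \<Rightarrow> config \<Rightarrow> config" where
  "asym_step A x y (m, r, i) =
     (case act A m of
        Read f \<Rightarrow> (f (symbol_at x i), r, min (Suc i) (length x))
      | Query j f \<Rightarrow> (f (symbol_at y j), r, i)
      | New_Pass m' \<Rightarrow> (m', Suc r, 0)
      | Output v \<Rightarrow> (m, r, i))"

definition config_at :: "'a asym_alg \<Rightarrow> 'a list \<Rightarrow> 'a list \<Rightarrow> nat \<Rightarrow> config" where
  "config_at A x y t = (asym_step A x y ^^ t) (init_mem A, 1, 0)"

definition outputs :: "'a asym_alg \<Rightarrow> 'a list \<Rightarrow> 'a list \<Rightarrow> real \<Rightarrow> bool" where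
  "outputs A x y v \<longleftrightarrow> (\<exists>t m r i. config_at A x y t = (m, r, i) \<and> act A m = Output v)"

definition computes_LCS_approx :: "'a asym_alg \<Rightarrow> 'a set \<Rightarrow> nat \<Rightarrow> real \<Rightarrow> bool" where
  "computes_LCS_approx A \<Sigma> n \<epsilon> \<longleftrightarrow>
     (\<forall>x \<in> words \<Sigma> n. \<forall>y \<in> words \<Sigma> n. \<exists>v. outputs A x y v \<and> is_LCS_approx \<epsilon> x y v)"

definition makes_passes :: "'a asym_alg \<Rightarrow> 'a set \<Rightarrow> nat \<Rightarrow> nat \<Rightarrow> bool" where
  "makes_passes A \<Sigma> n R \<longleftrightarrow>
     (\<forall>x \<in> words \<Sigma> n. \<forall>y \<in> words \<Sigma> n. \<forall>t m r i. config_at A x y t = (m, r, i) \<longrightarrow> r \<le> R)"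

definition uses_space :: "'a asym_alg \<Rightarrow> 'a set \<Rightarrow> nat \<Rightarrow> nat \<Rightarrow> bool" where
  "uses_space A \<Sigma> n s \<longleftrightarrow>
     (\<forall>x \<in> words \<Sigma> n. \<forall>y \<in> words \<Sigma> n. \<forall>t m r i. config_at A x y t = (m, r, i) \<longrightarrow> length m \<le> s)"

end

theory Submission
  imports Defs "HOL-Library.FuncSet"
begin

text \<open>
  Consider inputs \<open>x = g(p) g(p) ... g(p)\<close> that repeat one and the same window \<open>g(p)\<close>, against a
  fixed \<open>y\<close>. If the algorithm has few memory states, then for a suitable \<open>p\<close> the set \<open>U e\<close> of all
  \<open>p'\<close> that lead to the same crossing sequences at both ends of the \<open>e\<close>-th window is so large, for
  most \<open>e\<close>, that almost every coordinate of \<open>p'\<close> still takes almost every value on it. Replacing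
  the \<open>e\<close>-th window by \<open>g(q e)\<close> with \<open>q e \<in> U e\<close>, independently for all \<open>e\<close>, yields an input on
  which the algorithm behaves in every window as on one of the repetitive inputs. Hence its \<open>LCS\<close>
  exceeds that of the repetitive inputs by a factor of at most \<open>1 + \<epsilon>\<close>.

  If \<open>\<epsilon>\<close> is bounded below, \<open>p\<close> selects one of \<open>O(\<epsilon>)\<close> letters in each of
  \<open>\<Omega>(|\<Sigma>|/\<epsilon>)\<close> groups, and \<open>y\<close> lists all letters once. If \<open>\<epsilon>\<close> is small, there are
  \<open>|\<Sigma>|/2\<close> columns with two letters \<open>a\<close>, \<open>b\<close> each, \<open>y\<close> consists of runs
  \<open>a ... a b ... b a ... a\<close>, and \<open>p\<close> encodes \<open>\<Omega>(1/\<epsilon>)\<close> bits per column. A common subsequence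
  loses the \<open>a\<close>s inside the stretch from which the \<open>b\<close>s are taken; in a periodic word this loss is
  the same for all \<open>p\<close>, but it drops by one if the stretch crosses from one window into a
  different one. In both cases a common subsequence meets a diagonal of the (window, column) grid,
  and averaging over the diagonals produces one on which almost all exchanges are possible.
\<close>

section \<open>Elementary bounds for \<open>LCS\<close>\<close>

lemma LCS_ge:
  assumes "subseq z x" "subseq z y"
  shows "length z \<le> LCS x y"
proof -
  have "{length z |z. subseq z x \<and> subseq z y} \<subseteq> {..length x}"
    by (auto dest: list_emb_length)
  then have "finite {length z |z. subseq z x \<and> subseq z y}"
    by (rule finite_subset) simp
  then show ?thesis
    unfolding LCS_def using assms by (intro Max_ge) auto
qed

lemma LCS_le:
  assumes "\<And>z. subseq z x \<Longrightarrow> subseq z y \<Longrightarrow> length z \<le> b"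
  shows "LCS x y \<le> b"
proof -
  have "finite {length z |z. subseq z x \<and> subseq z y}"
    by (rule finite_subset[of _ "{..b}"]) (use assms in auto)
  moreover have "{length z |z. subseq z x \<and> subseq z y} \<noteq> {}"
    by (auto intro: exI[of _ "[]"])
  ultimately show ?thesis
    unfolding LCS_def using assms by (subst Max_le_iff) auto
qed

lemma LCS_replicate_same [simp]: "LCS (replicate n a) (replicate n a) = n"
  using LCS_ge[of "replicate n a" "replicate n a" "replicate n a"]
    LCS_le[of "replicate n a" "replicate n a" n]
  by (force dest: list_emb_length)

lemma LCS_disjoint:
  assumes "set x \<inter> set y = {}"
  shows "LCS x y = 0"
proof -
  have "z = []" if "subseq z x" "subseq z y" for z
    using that assms by (cases z) (auto dest!: list_emb_ConsD)
  then show ?thesis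
    using LCS_le[of x y 0] by auto
qed

section \<open>Crossing sequences\<close>

lemma config_at_0 [simp]: "config_at A x y 0 = (init_mem A, 1, 0)"
  by (simp add: config_at_def)

lemma config_at_Suc: "config_at A x y (Suc t) = asym_step A x y (config_at A x y t)"
  by (simp add: config_at_def)

lemma asym_step_mono:
  assumes "asym_step A x y (m, r, i) = (m', r', i')" "i \<le> length x"
  shows "i' \<le> length x" "r < r' \<or> r = r' \<and> i \<le> i'"
  using assms by (auto split: action.splits)

lemma config_at_pos_le:
  "config_at A x y t = (m, r, i) \<Longrightarrow> i \<le> length x"
proof (induction t arbitrary: m r i)
  case (Suc t)
  obtain m0 r0 i0 where c: "config_at A x y t = (m0, r0, i0)"
    by (cases "config_at A x y t")
  show ?case
    using Suc.IH[OF c] Suc.prems asym_step_mono(1)[of A x y m0 r0 i0 m r i]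
    by (simp add: config_at_Suc c del: asym_step.simps)
qed simp

lemma config_at_mono:
  assumes "t \<le> t'" "config_at A x y t = (m, r, i)" "config_at A x y t' = (m', r', i')"
  shows "r < r' \<or> r = r' \<and> i \<le> i'"
  using assms
proof (induction t' arbitrary: m' r' i' rule: dec_induct)
  case (step u)
  obtain m0 r0 i0 where c: "config_at A x y u = (m0, r0, i0)"
    by (cases "config_at A x y u")
  have "r0 < r' \<or> r0 = r' \<and> i0 \<le> i'"
    using step.prems(2) asym_step_mono(2)[of A x y m0 r0 i0 m' r' i'] config_at_pos_le[OF c]
    by (simp add: config_at_Suc c del: asym_step.simps)
  with step.IH[OF step.prems(1) c] show ?case
    by auto
qed auto

lemma config_at_pass_ge_1: "config_at A x y t = (m, r, i) \<Longrightarrow> 1 \<le> r"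
  using config_at_mono[of 0 t A x y "init_mem A" 1 0 m r i] by auto

lemma config_at_after_output:
  assumes "config_at A x y t = (m, r, i)" "act A m = Output v" "t \<le> t'"
  shows "config_at A x y t' = (m, r, i)"
  using assms(3)
proof (induction t' rule: dec_induct)
  case (step u)
  then show ?case
    using assms(2) by (simp add: config_at_Suc)
qed (use assms in simp)

lemma outputs_unique:
  assumes "outputs A x y v" "outputs A x y w"
  shows "v = w"
proof -
  obtain t m r i where 1: "config_at A x y t = (m, r, i)" "act A m = Output v"
    using assms(1) by (auto simp: outputs_def)
  obtain t' m' r' i' where 2: "config_at A x y t' = (m', r', i')" "act A m' = Output w"
    using assms(2) by (auto simp: outputs_def)
  show ?thesis
  proof (cases "t \<le> t'")
    case True
    then show ?thesis
      using config_at_after_output[OF 1 True] 1 2 by simp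
  next
    case False
    then show ?thesis
      using config_at_after_output[OF 2, of t] 1 2 by simp
  qed
qed

text \<open>This is the crossing sequence at position \<open>i\<close>: the memory contents on first
  arrival there, tagged by the pass. It is a set of pairs rather than a list because a pass may end
  before it reaches \<open>i\<close>.\<close>

definition first_visits :: "'a asym_alg \<Rightarrow> 'a list \<Rightarrow> 'a list \<Rightarrow> nat \<Rightarrow> (nat \<times> bool list) set" where
  "first_visits A x y i = {(r, m). \<exists>t. config_at A x y t = (m, r, i) \<and>
     (\<forall>t'<t. snd (config_at A x y t') \<noteq> (r, i))}"

lemma first_visits_visited:
  "(r, m) \<in> first_visits A x y i \<Longrightarrow> \<exists>t. config_at A x y t = (m, r, i)"
  by (auto simp: first_visits_def)

lemma first_visits_unique:
  assumes "(r, m) \<in> first_visits A x y i" "(r, m') \<in> first_visits A x y i"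
  shows "m = m'"
proof -
  obtain t where t: "config_at A x y t = (m, r, i)"
      "\<And>t'. t' < t \<Longrightarrow> snd (config_at A x y t') \<noteq> (r, i)"
    using assms(1) by (auto simp: first_visits_def)
  obtain u where u: "config_at A x y u = (m', r, i)"
      "\<And>t'. t' < u \<Longrightarrow> snd (config_at A x y t') \<noteq> (r, i)"
    using assms(2) by (auto simp: first_visits_def)
  have "t = u"
    using t(1) t(2)[of u] u(1) u(2)[of t] by (cases t u rule: linorder_cases) auto
  then show ?thesis
    using t u by simp
qed

lemma first_visitsI:
  assumes "config_at A x y t = (m0, r0, i0)" "config_at A x y (Suc t) = (m, r, i)"
    and "(r0, i0) \<noteq> (r, i)"
  shows "(r, m) \<in> first_visits A x y i"
proof -
  have "snd (config_at A x y t') \<noteq> (r, i)" if "t' < Suc t" for t'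
  proof
    assume a: "snd (config_at A x y t') = (r, i)"
    then obtain m' where "config_at A x y t' = (m', r, i)"
      by (metis prod.collapse)
    then have "r < r0 \<or> r = r0 \<and> i \<le> i0"
      using that config_at_mono[of t' t A x y m' r i m0 r0 i0] assms(1) by simp
    moreover have "r0 < r \<or> r0 = r \<and> i0 \<le> i"
      using config_at_mono[of t "Suc t" A x y m0 r0 i0 m r i] assms(1,2) by simp
    ultimately have "(r0, i0) = (r, i)"
      by auto
    then show False
      using assms(3) by simp
  qed
  then show ?thesis
    using assms(2) by (auto simp: first_visits_def)
qed

text \<open>
  Cut-and-paste: the run on \<open>x\<close> is glued together from runs on the inputs \<open>z e\<close>, where
  \<open>z e\<close> agrees with \<open>x\<close> on the \<open>e\<close>-th window of length \<open>l\<close>.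
\<close>
lemma config_at_hybrid:
  fixes z :: "nat \<Rightarrow> 'a list"
  assumes l: "0 < l"
    and len: "\<And>e. length (z e) = length x"
    and sym: "\<And>i. i < length x \<Longrightarrow> x ! i = z (i div l) ! i"
    and start: "\<And>e. first_visits A (z e) y 0 = F 0"
    and left: "\<And>e. first_visits A (z e) y (e * l) = F e"
    and right: "\<And>e. first_visits A (z e) y (Suc e * l) = F (Suc e)"
  shows "config_at A x y t = (m, r, i) \<Longrightarrow> \<exists>t'. config_at A (z (i div l)) y t' = (m, r, i)"
proof (induction t arbitrary: m r i)
  case 0
  then show ?case
    by (auto intro: exI[of _ 0])
next
  case (Suc t)
  obtain m0 r0 i0 where c: "config_at A x y t = (m0, r0, i0)"
    by (cases "config_at A x y t")
  define e where "e = i0 div l"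
  obtain t' where t': "config_at A (z e) y t' = (m0, r0, i0)"
    using Suc.IH[OF c] by (auto simp: e_def)
  have i0: "i0 \<le> length x"
    using config_at_pos_le[OF c] .
  have "symbol_at x i0 = symbol_at (z e) i0"
    using sym[of i0] by (simp add: symbol_at_def len e_def)
  then have "asym_step A x y (m0, r0, i0) = asym_step A (z e) y (m0, r0, i0)"
    by (auto simp: len split: action.splits)
  then have c': "config_at A (z e) y (Suc t') = (m, r, i)"
    using Suc.prems by (simp only: config_at_Suc c t')
  have st: "asym_step A x y (m0, r0, i0) = (m, r, i)"
    using Suc.prems by (simp only: config_at_Suc c)
  \<comment> \<open>The head leaves a window only by a rewind to position 0 or across its right end;
    a read at the end of the input does not move it. In the last two cases the arrival is a first
    visit, so a shared crossing sequence carries the configuration over to the next input.\<close>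
  consider "i div l = e" | "i = 0" "r = Suc r0" | "i = Suc i0" "i div l \<noteq> e"
    using st i0 by (cases "i0 = length x") (auto simp: e_def min_def split: action.splits if_splits)
  then show ?case
  proof cases
    case 1
    then show ?thesis
      using c' by blast
  next
    case 2
    have "(r, m) \<in> first_visits A (z e) y i"
      by (rule first_visitsI[OF t' c']) (use 2 in simp)
    then have "(r, m) \<in> first_visits A (z 0) y i"
      using start 2 by simp
    then show ?thesis
      using 2 by (auto dest: first_visits_visited)
  next
    case 3
    have i: "i = Suc e * l"
      using 3 by (metis div_Suc e_def mult.commute dvd_div_mult_self dvd_eq_mod_eq_0)
    have "(r, m) \<in> first_visits A (z e) y i"
      by (rule first_visitsI[OF t' c']) (use 3 in simp)
    then have "(r, m) \<in> first_visits A (z (Suc e)) y i"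
      using left right i by metis
    then show ?thesis
      using i l by (metis first_visits_visited nonzero_mult_div_cancel_right less_irrefl)
  qed
qed

lemma card_bool_lists_length_le: "card {m :: bool list. length m \<le> s} = 2 ^ Suc s - 1"
proof -
  have "card {m :: bool list. set m \<subseteq> UNIV \<and> length m \<le> s} = (\<Sum>i\<le>s. 2 ^ i)"
    by (subst card_lists_length_le) simp_all
  also have "\<dots> = 2 ^ Suc s - 1"
    by (induction s) auto
  finally show ?thesis
    by simp
qed

text \<open>A crossing sequence is a partial function from the \<open>R\<close> passes to memory
  contents. Each pass has \<open>2 ^ Suc s - 1\<close> possible contents plus \<open>None\<close>
  for a position not reached, hence \<open>2 ^ Suc s\<close> options.\<close>

lemma card_first_visits_le:
  assumes "makes_passes A \<Sigma> n R" "uses_space A \<Sigma> n s" "y \<in> words \<Sigma> n" "Z \<subseteq> words \<Sigma> n"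
  shows "finite ((\<lambda>x. first_visits A x y i) ` Z)"
    and "card ((\<lambda>x. first_visits A x y i) ` Z) \<le> 2 ^ (Suc s * R)"
proof -
  define B where "B = insert None (Some ` {m :: bool list. length m \<le> s})"
  define dec where "dec = (\<lambda>f :: nat \<Rightarrow> bool list option. {(r, m). r \<in> {1..R} \<and> f r = Some m})"
  have fin: "finite {m :: bool list. length m \<le> s}"
    using finite_lists_length_le[of "UNIV :: bool set" s] by simp
  have "card B = Suc (2 ^ Suc s - 1)"
    unfolding B_def using fin
    by (subst card_insert_disjoint) (auto simp: card_image card_bool_lists_length_le)
  then have cB: "card B = 2 ^ Suc s"
    by simp
  have fB: "finite ({1..R} \<rightarrow>\<^sub>E B)"
    by (rule finite_PiE) (use fin in \<open>auto simp: B_def\<close>)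
  have "first_visits A x y i \<in> dec ` ({1..R} \<rightarrow>\<^sub>E B)" if "x \<in> Z" for x
  proof -
    define V where "V = first_visits A x y i"
    have bd: "1 \<le> r \<and> r \<le> R \<and> length m \<le> s" if rm: "(r, m) \<in> V" for r m
    proof -
      obtain t where t: "config_at A x y t = (m, r, i)"
        using rm first_visits_visited[of r m A x y i] unfolding V_def by blast
      have "x \<in> words \<Sigma> n"
        using \<open>x \<in> Z\<close> assms(4) by blast
      then show ?thesis
        using t assms(1-3) config_at_pass_ge_1[OF t]
        unfolding makes_passes_def uses_space_def by blast
    qed
    define f where "f = (\<lambda>r\<in>{1..R}. if \<exists>m. (r, m) \<in> V then Some (THE m. (r, m) \<in> V) else None)"
    have the: "(THE m. (r, m) \<in> V) = m" if "(r, m) \<in> V" for r m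
      using that first_visits_unique unfolding V_def by blast
    have "f \<in> {1..R} \<rightarrow>\<^sub>E B"
      using bd the by (fastforce simp: f_def B_def)
    moreover have "dec f = V"
      using bd the by (auto simp: dec_def f_def split: if_splits)
    ultimately show ?thesis
      unfolding V_def by blast
  qed
  then have sub: "(\<lambda>x. first_visits A x y i) ` Z \<subseteq> dec ` ({1..R} \<rightarrow>\<^sub>E B)"
    by blast
  then show "finite ((\<lambda>x. first_visits A x y i) ` Z)"
    using fB by (meson finite_imageI finite_subset)
  have "card ((\<lambda>x. first_visits A x y i) ` Z) \<le> card ({1..R} \<rightarrow>\<^sub>E B)"
    using sub fB by (meson card_image_le card_mono finite_imageI le_trans)
  also have "\<dots> = 2 ^ (Suc s * R)"
    by (simp add: card_PiE cB power_mult[symmetric] del: power_Suc)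
  finally show "card ((\<lambda>x. first_visits A x y i) ` Z) \<le> 2 ^ (Suc s * R)" .
qed

section \<open>Counting\<close>

text \<open>\<open>U\<close> lies in the product of its projections, so \<open>ln (card U)\<close>
  is at most the sum of the logarithms of their sizes; \<open>ln x \<le> x - 1\<close> at
  \<open>x = d c / W\<close> turns each logarithm into a fraction of missing values.\<close>

lemma sum_missing_values_le:
  fixes U :: "(nat \<Rightarrow> nat) set"
  assumes U: "U \<subseteq> {..<M} \<rightarrow>\<^sub>E {..<W}" "U \<noteq> {}" and W: "0 < W"
  shows "real (\<Sum>c<M. W - card ((\<lambda>p. p c) ` U)) \<le> real W * ln (real (W ^ M) / real (card U))"
proof -
  define d where "d c = card ((\<lambda>p. p c) ` U)" for c
  have fU: "finite U"
    by (rule finite_subset[OF U(1)]) (simp add: finite_PiE)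
  have cU: "0 < card U"
    using fU U(2) by (simp add: card_gt_0_iff)
  have d: "0 < d c" for c
    using fU U(2) by (simp add: d_def card_gt_0_iff)
  have dW: "d c \<le> W" if "c < M" for c
  proof -
    have "(\<lambda>p. p c) ` U \<subseteq> {..<W}"
      using U(1) that by (auto simp: PiE_def Pi_def)
    then show ?thesis
      unfolding d_def by (metis card_lessThan card_mono finite_lessThan)
  qed
  have "U \<subseteq> (\<Pi>\<^sub>E c\<in>{..<M}. (\<lambda>p. p c) ` U)"
    using U(1) by (auto simp: PiE_def)
  then have "card U \<le> card (\<Pi>\<^sub>E c\<in>{..<M}. (\<lambda>p. p c) ` U)"
    using fU by (intro card_mono finite_PiE) auto
  also have "\<dots> = (\<Prod>c<M. d c)"
    by (simp add: card_PiE d_def)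
  finally have "real (card U) \<le> (\<Prod>c<M. real (d c))"
    by (metis of_nat_le_iff of_nat_prod)
  then have "ln (real (card U)) \<le> ln (\<Prod>c<M. real (d c))"
    using cU by (subst ln_le_cancel_iff) (auto intro: prod_pos simp: d)
  also have "\<dots> = (\<Sum>c<M. ln (real (d c)))"
    by (rule ln_prod) (auto simp: d)
  also have "\<dots> \<le> (\<Sum>c<M. ln (real W) + (real (d c) / real W - 1))"
  proof (rule sum_mono)
    fix c
    have "ln (real (d c) / real W) \<le> real (d c) / real W - 1"
      using d W by (intro ln_le_minus_one) simp
    then show "ln (real (d c)) \<le> ln (real W) + (real (d c) / real W - 1)"
      using d[of c] W by (simp add: ln_div)
  qed
  finally have *: "ln (real (card U)) \<le> real M * ln (real W) - (\<Sum>c<M. 1 - real (d c) / real W)"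
    by (simp add: sum.distrib sum_subtractf)
  have "real (\<Sum>c<M. W - d c) = (\<Sum>c<M. real W - real (d c))"
    using dW by (simp add: of_nat_diff)
  also have "\<dots> = real W * (\<Sum>c<M. 1 - real (d c) / real W)"
    using W by (simp add: sum_distrib_left right_diff_distrib)
  also have "\<dots> \<le> real W * (real M * ln (real W) - ln (real (card U)))"
    using * by (intro mult_left_mono) auto
  also have "real M * ln (real W) - ln (real (card U)) = ln (real (W ^ M) / real (card U))"
    using cU W by (simp add: ln_div ln_realpow)
  finally show ?thesis
    by (simp add: d_def)
qed

text \<open>An entropy bound: for uniform \<open>p\<close>, the average of the logarithm is the
  entropy of \<open>key p\<close>. The inverse class sizes sum to the number of classes, and
  \<open>ln x \<le> x - 1\<close> does the rest.\<close>

lemma sum_ln_class_le: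
  assumes P: "finite P" "P \<noteq> {}" and Q: "card (key ` P) \<le> Q"
  shows "(\<Sum>p\<in>P. ln (real (card P) / real (card {p' \<in> P. key p' = key p})))
    \<le> real (card P) * ln (real Q)"
proof -
  define u where "u p = real (card {p' \<in> P. key p' = key p})" for p
  have cP: "0 < card P"
    using P by (simp add: card_gt_0_iff)
  have "0 < card (key ` P)"
    using P by (simp add: card_gt_0_iff)
  then have Q0: "0 < Q"
    using Q by linarith
  have u: "0 < u p" if "p \<in> P" for p
    using that P unfolding u_def of_nat_0_less_iff card_gt_0_iff by auto
  have "(\<Sum>p\<in>P. 1 / u p) = (\<Sum>k\<in>key ` P. \<Sum>p\<in>{p \<in> P. key p = k}. 1 / u p)"
    using P(1) by (rule sum.image_gen)
  also have "\<dots> = (\<Sum>k\<in>key ` P. 1)"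
  proof (rule sum.cong[OF refl])
    fix k assume "k \<in> key ` P"
    then have "0 < card {p \<in> P. key p = k}"
      using P unfolding card_gt_0_iff by auto
    then show "(\<Sum>p\<in>{p \<in> P. key p = k}. 1 / u p) = 1"
      by (simp add: u_def)
  qed
  finally have inv: "(\<Sum>p\<in>P. 1 / u p) \<le> real Q"
    using Q by simp
  have "(\<Sum>p\<in>P. ln (real (card P) / u p))
      \<le> (\<Sum>p\<in>P. ln (real Q) + (real (card P) / real Q * (1 / u p) - 1))"
  proof (rule sum_mono)
    fix p assume p: "p \<in> P"
    have "ln (real (card P) / (real Q * u p)) \<le> real (card P) / (real Q * u p) - 1"
      using cP Q0 u[OF p] by (intro ln_le_minus_one) simp
    then show "ln (real (card P) / u p) \<le> ln (real Q) + (real (card P) / real Q * (1 / u p) - 1)"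
      using cP Q0 u[OF p] by (simp add: ln_div ln_mult)
  qed
  also have "\<dots> = real (card P) * ln (real Q) + (real (card P) / real Q * (\<Sum>p\<in>P. 1 / u p) - real (card P))"
    by (simp add: sum.distrib sum_subtractf sum_distrib_left)
  also have "\<dots> \<le> real (card P) * ln (real Q) + (real (card P) / real Q * real Q - real (card P))"
    using inv by (intro add_left_mono diff_right_mono mult_left_mono) auto
  also have "\<dots> = real (card P) * ln (real Q)"
    using Q0 by simp
  finally show ?thesis
    by (simp add: u_def)
qed

section \<open>Inputs composed of windows\<close>

lemma length_concat_windows:
  assumes "\<And>e. length (f e) = l"
  shows "length (concat (map f [0..<T])) = T * l"
  by (induction T) (auto simp: assms)

lemma nth_concat_windows:
  assumes "0 < l" "\<And>e. length (f e) = l" "i < T * l"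
  shows "concat (map f [0..<T]) ! i = f (i div l) ! (i mod l)"
  using assms(3)
proof (induction T)
  case (Suc T)
  show ?case
  proof (cases "i < T * l")
    case True
    then show ?thesis
      using Suc by (simp add: nth_append length_concat_windows[OF assms(2)])
  next
    case False
    then have "i div l = T"
      using Suc.prems by (intro div_nat_eqI) (auto simp: algebra_simps)
    then have "i mod l = i - T * l"
      by (simp add: minus_div_mult_eq_mod[symmetric])
    with False \<open>i div l = T\<close> show ?thesis
      by (simp add: nth_append length_concat_windows[OF assms(2)])
  qed
qed simp

text \<open>
  All windows of the inputs \<open>concat (map (\<lambda>e. g p) [0..<T]) @ pad\<close> encode the same \<open>p\<close>. For a
  suitable \<open>p\<close>, an algorithm with few memory states confuses, in almost every window, \<open>p\<close> with
  a set \<open>U e\<close> of parameters that misses few values of few coordinates, and the windows may be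
  exchanged independently of each other.
\<close>
lemma exchangeable_windows:
  fixes g :: "(nat \<Rightarrow> nat) \<Rightarrow> 'a list"
  assumes A: "makes_passes A \<Sigma> n R" "computes_LCS_approx A \<Sigma> n \<epsilon>" "uses_space A \<Sigma> n s"
    and \<epsilon>: "0 < \<epsilon>" and y: "y \<in> words \<Sigma> n" and l: "0 < l" and W: "0 < W"
    and len: "\<And>p. length (g p) = l"
    and set: "\<And>p. p \<in> {..<M} \<rightarrow>\<^sub>E {..<W} \<Longrightarrow> set (g p) \<subseteq> \<Sigma>"
    and pad: "set pad \<subseteq> \<Sigma>" "T * l + length pad = n"
    and L: "\<And>p. p \<in> {..<M} \<rightarrow>\<^sub>E {..<W} \<Longrightarrow> LCS (concat (map (\<lambda>e. g p) [0..<T]) @ pad) y \<le> L"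
  obtains U where "\<And>e. U e \<subseteq> {..<M} \<rightarrow>\<^sub>E {..<W}" "\<And>e. U e \<noteq> {}"
    and "(\<Sum>e<T. \<Sum>c<M. W - card ((\<lambda>p. p c) ` U e)) \<le> 3 * R * Suc s * T * W"
    and "\<forall>q. (\<forall>e. q e \<in> U e) \<longrightarrow>
      real (LCS (concat (map (\<lambda>e. g (q e)) [0..<T]) @ pad) y) \<le> (1 + \<epsilon>) * real L"
proof -
  define P where "P = {..<M} \<rightarrow>\<^sub>E {..<W}"
  define X where "X q = concat (map (\<lambda>e. g (q e)) [0..<T]) @ pad" for q :: "nat \<Rightarrow> nat \<Rightarrow> nat"
  define V where "V i p = first_visits A (X (\<lambda>_. p)) y i" for i p
  \<comment> \<open>Besides the two ends of window \<open>e\<close>, position 0 is included because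
    every new pass starts there.\<close>
  define key where "key e p = (V 0 p, V (e * l) p, V (Suc e * l) p)" for e p
  define U where "U p e = {p' \<in> P. key e p' = key e p}" for p e
  define D where "D p e = (\<Sum>c<M. W - card ((\<lambda>p. p c) ` U p e))" for p e
  define N where "N = Suc s * R"
  have fP: "finite P"
    by (simp add: P_def finite_PiE)
  have cP: "card P = W ^ M"
    by (simp add: P_def card_PiE)
  then have P: "P \<noteq> {}"
    using W fP by (metis card.empty power_not_zero less_irrefl)
  have Xlen: "length (X q) = n" for q
    using pad(2) by (simp add: X_def length_concat_windows[OF len])
  have Xw: "X q \<in> words \<Sigma> n" if "\<And>e. q e \<in> P" for q
  proof -
    have "set (g (q e)) \<subseteq> \<Sigma>" for e
      using that[of e] set[of "q e"] by (simp add: P_def)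
    then show ?thesis
      using pad(1) Xlen[of q] by (auto simp: words_def X_def)
  qed
  \<comment> \<open>In the padding the parameter has no influence, so a head inside the padding
    needs no separate treatment.\<close>
  have Xnth: "X q ! i = X (\<lambda>_. q (i div l)) ! i" for q i
    by (cases "i < T * l")
      (simp_all add: X_def nth_append length_concat_windows[OF len] nth_concat_windows[OF l len])
  have fV: "finite (V i ` P)" and cV: "card (V i ` P) \<le> 2 ^ N" for i
  proof -
    have sub: "(\<lambda>p. X (\<lambda>_. p)) ` P \<subseteq> words \<Sigma> n"
      using Xw by auto
    show "finite (V i ` P)" "card (V i ` P) \<le> 2 ^ N"
      using card_first_visits_le[OF A(1) A(3) y sub, of i]
      by (simp_all add: V_def image_image N_def)
  qed
  have ck: "card (key e ` P) \<le> 2 ^ (3 * N)" for e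
  proof -
    have "card (key e ` P) \<le> card ((V 0 ` P) \<times> (V (e * l) ` P) \<times> (V (Suc e * l) ` P))"
      by (rule card_mono) (auto simp: fV key_def)
    also have "\<dots> \<le> 2 ^ N * (2 ^ N * 2 ^ N)"
      unfolding card_cartesian_product by (intro mult_mono cV) auto
    also have "\<dots> = 2 ^ (3 * N)"
      by (simp add: power_add[symmetric] mult.commute)
    finally show ?thesis .
  qed
  have "(\<Sum>p\<in>P. real (D p e)) \<le> real (card P) * (real W * real (3 * N))" for e
  proof -
    have "(\<Sum>p\<in>P. real (D p e)) \<le> (\<Sum>p\<in>P. real W * ln (real (card P) / real (card (U p e))))"
    proof (rule sum_mono)
      fix p assume "p \<in> P"
      then have "U p e \<subseteq> {..<M} \<rightarrow>\<^sub>E {..<W}" "U p e \<noteq> {}"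
        by (auto simp: U_def P_def)
      from sum_missing_values_le[OF this W]
      show "real (D p e) \<le> real W * ln (real (card P) / real (card (U p e)))"
        by (simp add: D_def cP)
    qed
    also have "\<dots> = real W * (\<Sum>p\<in>P. ln (real (card P) / real (card (U p e))))"
      by (simp add: sum_distrib_left)
    also have "\<dots> \<le> real W * (real (card P) * ln (real (2 ^ (3 * N))))"
      unfolding U_def by (intro mult_left_mono sum_ln_class_le fP P ck) simp
    also have "\<dots> \<le> real W * (real (card P) * real (3 * N))"
    proof -
      have "ln (real (2 ^ (3 * N))) = real (3 * N) * ln 2"
        by (simp add: ln_realpow)
      also have "\<dots> \<le> real (3 * N) * 1"
        by (intro mult_left_mono) (use ln_le_minus_one[of "2::real"] in auto)
      finally show ?thesis
        by (intro mult_left_mono) auto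
    qed
    finally show ?thesis
      by (simp only: mult.left_commute)
  qed
  then have "(\<Sum>e<T. \<Sum>p\<in>P. real (D p e)) \<le> (\<Sum>e<T. real (card P) * (real W * real (3 * N)))"
    by (intro sum_mono)
  also have "\<dots> = (\<Sum>p\<in>P. real (3 * N * T * W))"
    by (simp add: algebra_simps)
  finally have "(\<Sum>p\<in>P. real (\<Sum>e<T. D p e)) \<le> (\<Sum>p\<in>P. real (3 * N * T * W))"
    by (subst (asm) sum.swap) simp
  then have "\<exists>p\<in>P. real (\<Sum>e<T. D p e) \<le> real (3 * N * T * W)"
    using sum_strict_mono[OF fP P, of "\<lambda>_. real (3 * N * T * W)" "\<lambda>p. real (\<Sum>e<T. D p e)"]
    by (meson linorder_not_le)
  then obtain p where p: "p \<in> P" "(\<Sum>e<T. D p e) \<le> 3 * N * T * W"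
    by (auto simp del: of_nat_mult of_nat_sum)
  show thesis
  proof (rule that[of "U p"])
    show "U p e \<subseteq> {..<M} \<rightarrow>\<^sub>E {..<W}" for e
      by (auto simp: U_def P_def)
    show "U p e \<noteq> {}" for e
      using p(1) by (auto simp: U_def)
    show "(\<Sum>e<T. \<Sum>c<M. W - card ((\<lambda>p. p c) ` U p e)) \<le> 3 * R * Suc s * T * W"
      using p(2) by (simp add: D_def N_def algebra_simps)
    show "\<forall>q. (\<forall>e. q e \<in> U p e) \<longrightarrow>
        real (LCS (concat (map (\<lambda>e. g (q e)) [0..<T]) @ pad) y) \<le> (1 + \<epsilon>) * real L"
    proof (intro allI impI)
      fix q assume q: "\<forall>e. q e \<in> U p e"
      have qP: "q e \<in> P" for e
        using q by (simp add: U_def)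
      have qk: "key e (q e) = key e p" for e
        using q by (simp add: U_def)
      obtain v where v: "outputs A (X q) y v" "real (LCS (X q) y) \<le> v"
        using A(2) Xw[of q] qP y by (force simp: computes_LCS_approx_def is_LCS_approx_def)
      obtain t m r i where c: "config_at A (X q) y t = (m, r, i)" "act A m = Output v"
        using v(1) by (auto simp: outputs_def)
      \<comment> \<open>Here \<open>i\<close> is the head position at the time of output. The same
        memory content occurs on the repetitive input of parameter \<open>q (i div l)\<close>, so
        this single input already yields \<open>v\<close>, and its small \<open>LCS\<close> bounds
        \<open>v\<close>.\<close>
      have "\<exists>t'. config_at A (X (\<lambda>_. q (i div l))) y t' = (m, r, i)"
      proof (rule config_at_hybrid[where z = "\<lambda>e. X (\<lambda>_. q e)" and F = "\<lambda>e. V (e * l) p", OF l _ _ _ _ _ c(1)])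
        show "length (X (\<lambda>_. q e)) = length (X q)" for e
          by (simp add: Xlen)
        show "X q ! i = X (\<lambda>_. q (i div l)) ! i" for i
          by (rule Xnth)
        show "first_visits A (X (\<lambda>_. q e)) y 0 = V (0 * l) p"
          "first_visits A (X (\<lambda>_. q e)) y (e * l) = V (e * l) p"
          "first_visits A (X (\<lambda>_. q e)) y (Suc e * l) = V (Suc e * l) p" for e
          using qk[of e] by (simp_all add: key_def V_def)
      qed
      then have "outputs A (X (\<lambda>_. q (i div l))) y v"
        using c(2) by (auto simp: outputs_def)
      moreover obtain v' where v': "outputs A (X (\<lambda>_. q (i div l))) y v'"
          "v' \<le> (1 + \<epsilon>) * real (LCS (X (\<lambda>_. q (i div l))) y)"
        using A(2) Xw[of "\<lambda>_. q (i div l)"] qP y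
        by (force simp: computes_LCS_approx_def is_LCS_approx_def)
      ultimately have "v \<le> (1 + \<epsilon>) * real (LCS (X (\<lambda>_. q (i div l))) y)"
        using outputs_unique by metis
      also have "\<dots> \<le> (1 + \<epsilon>) * real L"
        using L[of "q (i div l)"] qP \<epsilon> by (intro mult_left_mono) (auto simp: X_def P_def)
      finally show "real (LCS (concat (map (\<lambda>e. g (q e)) [0..<T]) @ pad) y) \<le> (1 + \<epsilon>) * real L"
        using v(2) by (simp add: X_def)
    qed
  qed
qed

text \<open>Without memory bits, the only content \<open>[]\<close> would dictate one output for all
  inputs, but two words without common letters and two equal words need different values. Positive
  \<open>s\<close> later allows \<open>Suc s\<close> to be replaced by \<open>2 * s\<close>.\<close>

lemma uses_space_pos:
  assumes "finite \<Sigma>" "2 \<le> card \<Sigma>" "0 < n" "computes_LCS_approx A \<Sigma> n \<epsilon>" "uses_space A \<Sigma> n s"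
  shows "1 \<le> s"
proof (rule ccontr)
  assume "\<not> 1 \<le> s"
  then have s: "s = 0"
    by simp
  obtain a b where ab: "a \<in> \<Sigma>" "b \<in> \<Sigma>" "a \<noteq> b"
    using assms(1,2) by (metis card_le_Suc0_iff_eq not_less_eq_eq numeral_2_eq_2)
  define x where "x = replicate n a"
  define y where "y = replicate n b"
  have xy: "x \<in> words \<Sigma> n" "y \<in> words \<Sigma> n"
    using ab by (auto simp: words_def x_def y_def)
  have out: "act A [] = Output v" if out: "outputs A z y v" "z \<in> words \<Sigma> n" for z v
  proof -
    obtain t m r i where c: "config_at A z y t = (m, r, i)" "act A m = Output v"
      using out by (auto simp: outputs_def)
    then have "length m \<le> s"
      using assms(5) out(2) xy(2) unfolding uses_space_def by blast
    with c s show ?thesis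
      by simp
  qed
  obtain v where v: "outputs A x y v" "v \<le> 0"
    using assms(4) xy LCS_disjoint[of x y] ab assms(3)
    by (force simp: computes_LCS_approx_def is_LCS_approx_def x_def y_def)
  obtain w where w: "outputs A y y w" "real n \<le> w"
    using assms(4) xy by (force simp: computes_LCS_approx_def is_LCS_approx_def y_def)
  show False
    using out[OF v(1) xy(1)] out[OF w(1) xy(2)] v(2) w(2) assms(3) by simp
qed

section \<open>Subsequences, and averaging over diagonals\<close>

lemma subseq_concat_map:
  assumes "\<And>i. i \<in> set I \<Longrightarrow> subseq (f i) (h i)"
  shows "subseq (concat (map f I)) (concat (map h I))"
  using assms by (induction I) (auto intro: list_emb_append_mono)

lemma subseq_imp_subset: "subseq xs ys \<Longrightarrow> set xs \<subseteq> set ys"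
  by (induction rule: list_emb.induct) auto

text \<open>The diagonals \<open>(a + l, l)\<close> for distinct \<open>a\<close> are disjoint and,
  for \<open>a < D\<close>, stay within the \<open>2 * D\<close> rows; hence one of these
  \<open>D\<close> diagonals carries at most the average share of the total.\<close>

lemma exists_good_diagonal:
  fixes f :: "nat \<Rightarrow> nat \<Rightarrow> nat"
  assumes "0 < D"
  obtains a where "a < D" "D * (\<Sum>l<D. f (a + l) l) \<le> (\<Sum>e<2 * D. \<Sum>l<D. f e l)"
proof -
  let ?S = "\<Sum>e<2 * D. \<Sum>l<D. f e l"
  have "(\<Sum>a<D. \<Sum>l<D. f (a + l) l) = (\<Sum>l<D. \<Sum>a<D. f (a + l) l)"
    by (rule sum.swap)
  also have "\<dots> \<le> (\<Sum>l<D. \<Sum>e<2 * D. f e l)"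
  proof (rule sum_mono)
    fix l assume l: "l \<in> {..<D}"
    have "(\<Sum>a<D. f (a + l) l) = (\<Sum>e\<in>(\<lambda>a. a + l) ` {..<D}. f e l)"
      by (subst sum.reindex) (auto simp: inj_on_def)
    also have "\<dots> \<le> (\<Sum>e<2 * D. f e l)"
      using l by (intro sum_mono2) auto
    finally show "(\<Sum>a<D. f (a + l) l) \<le> (\<Sum>e<2 * D. f e l)" .
  qed
  also have "\<dots> = ?S"
    by (rule sum.swap)
  finally have tot: "(\<Sum>a<D. \<Sum>l<D. f (a + l) l) \<le> ?S" .
  show thesis
  proof (rule ccontr)
    assume "\<not> thesis"
    then have "?S < D * (\<Sum>l<D. f (a + l) l)" if "a < D" for a
      using that \<open>\<And>a. a < D \<Longrightarrow> D * (\<Sum>l<D. f (a + l) l) \<le> ?S \<Longrightarrow> thesis\<close> by fastforce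
    then have "(\<Sum>a<D. ?S) < (\<Sum>a<D. D * (\<Sum>l<D. f (a + l) l))"
      using assms by (intro sum_strict_mono) auto
    also have "\<dots> = D * (\<Sum>a<D. \<Sum>l<D. f (a + l) l)"
      by (simp add: sum_distrib_left)
    also have "\<dots> \<le> D * ?S"
      using tot by (intro mult_left_mono) auto
    finally show False
      by simp
  qed
qed

lemma sum_missing_letters:
  assumes "0 < W" "\<And>c. c < M \<Longrightarrow> S c \<subseteq> {..<W}"
  shows "(\<Sum>l<M * W. if l mod W \<in> S (l div W) then 0 else 1) = (\<Sum>c<M. W - card (S c))"
proof -
  have "(\<Sum>l\<in>{c * W..<c * W + W}. if l mod W \<in> S (l div W) then 0 else 1) = W - card (S c)"
    if "c < M" for c
  proof -
    have "(\<Sum>l\<in>{c * W..<c * W + W}. if l mod W \<in> S (l div W) then 0 else 1)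
        = (\<Sum>v<W. if (c * W + v) mod W \<in> S ((c * W + v) div W) then 0 else 1)"
      using sum.shift_bounds_nat_ivl[of "\<lambda>l. if l mod W \<in> S (l div W) then 0 else 1" 0 "c * W" W]
      by (simp only: atLeast0LessThan add.commute[of _ "c * W"] add_0_right)
    also have "\<dots> = (\<Sum>v<W. if v \<in> S c then 0 else 1)"
      using assms(1) by (intro sum.cong) auto
    also have "\<dots> = card ({..<W} - S c)"
      by (simp add: sum.If_cases Diff_eq Collect_neg_eq)
    also have "\<dots> = W - card (S c)"
      using assms(2)[OF that] by (subst card_Diff_subset) (auto intro: finite_subset)
    finally show ?thesis .
  qed
  then have "(\<Sum>c<M. \<Sum>l\<in>{c * W..<c * W + W}. if l mod W \<in> S (l div W) then 0 else 1)
      = (\<Sum>c<M. W - card (S c))"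
    by (intro sum.cong) auto
  then show ?thesis
    by (simp only: sum.nat_group)
qed

section \<open>Large approximation factors\<close>

text \<open>
  Here \<open>y\<close> lists \<open>M\<close> groups of \<open>W\<close> letters once each, and a window contains one letter of
  every group. An input with constant windows has at most \<open>M\<close> (with padding, \<open>M + 1\<close>) letters
  in common with \<open>y\<close>; exchanging windows produces nearly all \<open>M * W\<close> letters in increasing order.
\<close>
lemma space_bound_large_eps:
  assumes \<Sigma>: "finite \<Sigma>" "M * W + 1 \<le> card \<Sigma>"
    and A: "makes_passes A \<Sigma> n R" "computes_LCS_approx A \<Sigma> n \<epsilon>" "uses_space A \<Sigma> n s"
    and \<epsilon>: "0 < \<epsilon>" and M: "0 < M" and W: "4 * (1 + \<epsilon>) < real W" and n: "2 * (M * W) * M \<le> n"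
  shows "M < 12 * R * Suc s"
proof (rule ccontr)
  assume "\<not> M < 12 * R * Suc s"
  then have big: "12 * R * Suc s \<le> M"
    by simp
  have W0: "0 < W"
    using W \<epsilon> by (cases W) auto
  define D where "D = M * W"
  have D: "0 < D"
    using M W0 by (simp add: D_def)
  obtain lt where lt: "bij_betw lt {..<card \<Sigma>} \<Sigma>"
    using ex_bij_betw_nat_finite[OF \<Sigma>(1)] by (auto simp: atLeast0LessThan)
  have lt_in: "lt i \<in> \<Sigma>" if "i \<le> D" for i
    using that \<Sigma>(2) bij_betwE[OF lt] by (simp add: D_def)
  have lt_inj: "lt i = lt j \<longleftrightarrow> i = j" if "i \<le> D" "j \<le> D" for i j
    using that \<Sigma>(2) lt by (auto simp: D_def bij_betw_def inj_on_def)
  define g where "g p = map (\<lambda>c. lt (c * W + p c)) [0..<M]" for p :: "nat \<Rightarrow> nat"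
  \<comment> \<open>The letter \<open>lt 0\<close> can be matched only once in \<open>y\<close>, and
    the filler \<open>lt D\<close> of \<open>y\<close> never occurs in an input, so the paddings add
    at most one common letter to the \<open>M\<close> letters of a window.\<close>
  define pad where "pad = replicate (n - 2 * D * M) (lt 0)"
  define y where "y = map lt [0..<D] @ replicate (n - D) (lt D)"
  have cW: "c * W + v < D" if "c < M" "v < W" for c v
  proof -
    have "c * W + v < Suc c * W"
      using that by simp
    also have "\<dots> \<le> D"
      unfolding D_def using that by (intro mult_right_mono) auto
    finally show ?thesis .
  qed
  have pc: "c * W + p c < D" if "p \<in> {..<M} \<rightarrow>\<^sub>E {..<W}" "c < M" for p c
    using that cW[of c "p c"] by auto
  have "D \<le> 2 * D * M"
    using M by simp
  then have Dn: "D \<le> n"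
    using n unfolding D_def by linarith
  have y: "y \<in> words \<Sigma> n"
    using lt_in Dn by (auto simp: y_def words_def)
  have glen: "length (g p) = M" for p
    by (simp add: g_def)
  have gset: "set (g p) \<subseteq> \<Sigma>" if "p \<in> {..<M} \<rightarrow>\<^sub>E {..<W}" for p
    using pc[OF that] lt_in by (force simp: g_def)
  have padset: "set pad \<subseteq> \<Sigma>"
    using lt_in[of 0] by (auto simp: pad_def)
  have padlen: "2 * D * M + length pad = n"
    using n by (simp add: pad_def D_def)
  have L: "LCS (concat (map (\<lambda>e. g p) [0..<2 * D]) @ pad) y \<le> M + 1"
    if p: "p \<in> {..<M} \<rightarrow>\<^sub>E {..<W}" for p
  proof (rule LCS_le)
    fix z assume z: "subseq z (concat (map (\<lambda>e. g p) [0..<2 * D]) @ pad)" "subseq z y"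
    define S where "S = insert (lt 0) ((\<lambda>c. lt (c * W + p c)) ` {..<M})"
    have "card S \<le> Suc (card ((\<lambda>c. lt (c * W + p c)) ` {..<M}))"
      unfolding S_def by (intro card_insert_le_m1) auto
    also have "\<dots> \<le> Suc (card {..<M})"
      by (intro Suc_le_mono[THEN iffD2] card_image_le) simp
    finally have cS: "card S \<le> M + 1"
      by simp
    have "set z \<subseteq> set (concat (map (\<lambda>e. g p) [0..<2 * D]) @ pad)"
      using z(1) by (rule subseq_imp_subset)
    also have "\<dots> \<subseteq> S"
    proof -
      have "set (g p) \<subseteq> S" "set pad \<subseteq> S"
        by (auto simp: S_def g_def pad_def set_replicate_conv_if)
      then show ?thesis
        by auto
    qed
    finally have "filter (\<lambda>a. a \<in> S) z = z"
      by (intro filter_True) auto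
    moreover have "lt D \<notin> S"
    proof -
      have "lt (c * W + p c) \<noteq> lt D" if "c < M" for c
        using pc[OF p that] by (simp add: lt_inj)
      then show ?thesis
        using D lt_inj[of 0 D] unfolding S_def by fastforce
    qed
    then have "filter (\<lambda>a. a \<in> S) y = filter (\<lambda>a. a \<in> S) (map lt [0..<D])"
      by (simp add: y_def)
    ultimately have "subseq z (filter (\<lambda>a. a \<in> S) (map lt [0..<D]))"
      using subseq_filter[OF z(2), of "\<lambda>a. a \<in> S"] by simp
    then have "length z \<le> length (filter (\<lambda>a. a \<in> S) (map lt [0..<D]))"
      by (rule list_emb_length)
    also have "\<dots> = card (set (filter (\<lambda>a. a \<in> S) (map lt [0..<D])))"
      by (intro distinct_card[symmetric] distinct_filter)
        (auto simp: distinct_map inj_on_def lt_inj)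
    also have "\<dots> \<le> card S"
      by (intro card_mono) (auto simp: S_def)
    finally show "length z \<le> M + 1"
      using cS by simp
  qed
  obtain U where U: "\<And>e. U e \<subseteq> {..<M} \<rightarrow>\<^sub>E {..<W}" "\<And>e. U e \<noteq> {}"
    and miss: "(\<Sum>e<2 * D. \<Sum>c<M. W - card ((\<lambda>p. p c) ` U e)) \<le> 3 * R * Suc s * (2 * D) * W"
    and hyb: "\<forall>q. (\<forall>e. q e \<in> U e) \<longrightarrow>
      real (LCS (concat (map (\<lambda>e. g (q e)) [0..<2 * D]) @ pad) y) \<le> (1 + \<epsilon>) * real (M + 1)"
    by (rule exchangeable_windows[where g = g and M = M and L = "M + 1",
          OF A \<epsilon> y M W0 glen gset padset padlen L])
      (assumption | rule that)+
  define good where "good e l \<longleftrightarrow> l mod W \<in> (\<lambda>p. p (l div W)) ` U e" for e l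
  define f where "f e l = (if good e l then 0 else 1 :: nat)" for e l
  have "(\<Sum>l<D. f e l) = (\<Sum>c<M. W - card ((\<lambda>p. p c) ` U e))" for e
    unfolding f_def good_def D_def
    by (rule sum_missing_letters[OF W0]) (use U(1)[of e] in \<open>auto simp: PiE_def Pi_def\<close>)
  then have miss': "(\<Sum>e<2 * D. \<Sum>l<D. f e l) \<le> 3 * R * Suc s * (2 * D) * W"
    using miss by simp
  obtain a where a: "a < D" "D * (\<Sum>l<D. f (a + l) l) \<le> (\<Sum>e<2 * D. \<Sum>l<D. f e l)"
    using exists_good_diagonal[OF D] by blast
  have "D * (\<Sum>l<D. f (a + l) l) \<le> D * (6 * R * Suc s * W)"
    using order_trans[OF a(2) miss'] by (simp add: algebra_simps)
  then have "(\<Sum>l<D. f (a + l) l) \<le> 6 * R * Suc s * W"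
    using D by (metis mult_le_cancel1)
  then have "2 * (\<Sum>l<D. f (a + l) l) \<le> 12 * R * Suc s * W"
    by (simp add: algebra_simps)
  also have "\<dots> \<le> D"
    unfolding D_def using big by (intro mult_right_mono) auto
  finally have bad: "2 * (\<Sum>l<D. f (a + l) l) \<le> D" .
  define G where "G = {l. l < D \<and> good (a + l) l}"
  have "(\<Sum>l<D. f (a + l) l) = card ({..<D} - G)"
    by (simp add: f_def sum.If_cases G_def Diff_eq Collect_neg_eq Collect_conj_eq lessThan_def Int_Un_distrib)
  moreover have "card ({..<D} - G) = D - card G"
    by (subst card_Diff_subset) (auto simp: G_def intro: finite_subset[of _ "{..<D}"])
  ultimately have cG: "D \<le> 2 * card G"
    using bad by linarith
  \<comment> \<open>Window \<open>a + l\<close> with \<open>l \<in> G\<close> is made to contain the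
    letter \<open>lt l\<close>; every other window takes an arbitrary member of
    \<open>U e\<close>.\<close>
  define q where "q e = (SOME p. p \<in> U e \<and> (a \<le> e \<and> e - a \<in> G \<longrightarrow> p ((e - a) div W) = (e - a) mod W))" for e
  have "\<exists>p. p \<in> U e \<and> (a \<le> e \<and> e - a \<in> G \<longrightarrow> p ((e - a) div W) = (e - a) mod W)" for e
    using U(2)[of e] by (cases "a \<le> e \<and> e - a \<in> G") (auto simp: G_def good_def)
  then have q: "q e \<in> U e \<and> (a \<le> e \<and> e - a \<in> G \<longrightarrow> q e ((e - a) div W) = (e - a) mod W)" for e
    unfolding q_def by (rule someI_ex)
  define z where "z = concat (map (\<lambda>l. if l \<in> G then [lt l] else []) [0..<D])"
  have z: "z = map lt (filter (\<lambda>l. l \<in> G) [0..<D])"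
    unfolding z_def by (induction D) auto
  have "subseq z y"
    unfolding z y_def by (intro list_emb_prefix subseq_map) simp
  moreover have "subseq z (concat (map (\<lambda>e. g (q e)) [0..<2 * D]) @ pad)"
  proof -
    have "subseq z (concat (map (\<lambda>l. g (q (a + l))) [0..<D]))"
      unfolding z_def
    proof (rule subseq_concat_map)
      fix l assume "l \<in> set [0..<D]"
      then have "l div W < M"
        by (simp add: D_def less_mult_imp_div_less)
      then have "lt (l div W * W + q (a + l) (l div W)) \<in> set (g (q (a + l)))"
        by (auto simp: g_def)
      then show "subseq (if l \<in> G then [lt l] else []) (g (q (a + l)))"
        using q[of "a + l"] by (auto simp: subseq_singleton_left)
    qed
    also have "map (\<lambda>l. g (q (a + l))) [0..<D] = map (\<lambda>e. g (q e)) [a..<a + D]"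
      by (rule nth_equalityI) auto
    also have "subseq (concat \<dots>) (concat (map (\<lambda>e. g (q e)) [0..<2 * D]))"
    proof -
      have "[0..<2 * D] = [0..<a] @ [a..<a + D] @ [a + D..<2 * D]"
        using a(1) upt_add_eq_append[of 0 a "2 * D - a"] upt_add_eq_append[of a "a + D" "D - a"]
        by (simp add: mult_2)
      then show ?thesis
        by (simp add: list_emb_append2 list_emb_prefix)
    qed
    finally show ?thesis
      by (rule list_emb_prefix)
  qed
  ultimately have "length z \<le> LCS (concat (map (\<lambda>e. g (q e)) [0..<2 * D]) @ pad) y"
    by (intro LCS_ge)
  moreover have "length z = card G"
    unfolding z by (simp add: distinct_length_filter G_def Int_def) (metis (lifting) Collect_cong)
  ultimately have "real (card G) \<le> (1 + \<epsilon>) * real (M + 1)"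
    using hyb[rule_format, of q] q by fastforce
  also have "\<dots> \<le> (1 + \<epsilon>) * real (2 * M)"
    using M \<epsilon> by (intro mult_left_mono) auto
  finally have "real D \<le> 2 * ((1 + \<epsilon>) * real (2 * M))"
    using cG by linarith
  then have "real M * real W \<le> real M * (4 * (1 + \<epsilon>))"
    by (simp add: D_def algebra_simps)
  then show False
    using M W by (simp add: mult_le_cancel_left)
qed

section \<open>Small approximation factors: the two-letter gadget\<close>

lemma subseq_count_list_le: "subseq x y \<Longrightarrow> count_list x c \<le> count_list y c"
  by (induction rule: list_emb.induct) auto

lemma count_list_replicate: "count_list (replicate n a) b = (if a = b then n else 0)"
  by (induction n) auto

lemma subseq_replicate_iff: "subseq (replicate j c) x \<longleftrightarrow> j \<le> count_list x c"
proof
  show "subseq (replicate j c) x \<Longrightarrow> j \<le> count_list x c"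
    using subseq_count_list_le[of "replicate j c" x c] by (simp add: count_list_replicate)
  show "j \<le> count_list x c \<Longrightarrow> subseq (replicate j c) x"
  proof (induction x arbitrary: j)
    case (Cons d x)
    show ?case
    proof (cases "j = 0 \<or> d = c")
      case True
      then show ?thesis
        using Cons.prems Cons.IH[of "j - 1"] by (cases j) auto
    next
      case False
      then show ?thesis
        using Cons.prems Cons.IH[of j] by (simp add: list_emb_Cons)
    qed
  qed simp
qed

lemma subseq_of_replicate:
  assumes "subseq z (replicate n c)"
  shows "z = replicate (length z) c" "length z \<le> n"
proof -
  have "\<forall>d \<in> set z. d = c"
    using subseq_imp_subset[OF assms] by (auto simp: set_replicate_conv_if split: if_splits)
  then show "z = replicate (length z) c"
    by (intro replicate_eqI) auto
  show "length z \<le> n"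
    using list_emb_length[OF assms] by simp
qed

text \<open>Any two \<open>a\<close>s are separated by a \<open>b\<close>, and the last \<open>a\<close> is followed by a \<open>b\<close>.\<close>
definition spread :: "'a \<Rightarrow> 'a \<Rightarrow> 'a list \<Rightarrow> bool" where
  "spread a b x \<longleftrightarrow> (\<forall>g. sublist g x \<longrightarrow> count_list g a \<le> count_list g b + 1) \<and>
     (\<forall>g. suffix g x \<longrightarrow> count_list g a \<le> count_list g b)"

text \<open>A factor across the border is a suffix of \<open>x\<close> followed by a prefix of
  \<open>y\<close>, and only the latter may have an excess of one. This is why \<open>spread\<close>
  has a stricter clause for suffixes.\<close>

lemma spread_append:
  assumes "spread a b x" "spread a b y"
  shows "spread a b (x @ y)"
proof -
  have "count_list g a \<le> count_list g b + 1" if "sublist g (x @ y)" for g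
  proof -
    consider "sublist g x" | "sublist g y" | g1 g2 where "g = g1 @ g2" "suffix g1 x" "prefix g2 y"
      using \<open>sublist g (x @ y)\<close> by (auto simp: sublist_append)
    then show ?thesis
    proof cases
      case 3
      then have "count_list g1 a \<le> count_list g1 b" "count_list g2 a \<le> count_list g2 b + 1"
        using assms by (auto simp: spread_def)
      then show ?thesis
        using 3 by simp
    qed (use assms in \<open>auto simp: spread_def\<close>)
  qed
  moreover have "count_list g a \<le> count_list g b" if "suffix g (x @ y)" for g
  proof -
    have y: "count_list y a \<le> count_list y b"
      using assms(2) by (auto simp: spread_def)
    consider "suffix g y" | g1 where "g = g1 @ y" "suffix g1 x"
      using \<open>suffix g (x @ y)\<close> by (auto simp: suffix_append)
    then show ?thesis
    proof cases
      case 2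
      then have "count_list g1 a \<le> count_list g1 b"
        using assms(1) by (auto simp: spread_def)
      then show ?thesis
        using 2 y by simp
    qed (use assms in \<open>auto simp: spread_def\<close>)
  qed
  ultimately show ?thesis
    by (simp add: spread_def)
qed

lemma spread_without: "a \<notin> set x \<Longrightarrow> spread a b x"
  by (auto simp: spread_def dest!: set_mono_sublist set_mono_suffix intro!: le_trans[OF eq_imp_le[OF count_notin]])

lemma spread_concat:
  assumes "\<And>x. x \<in> set xs \<Longrightarrow> spread a b x"
  shows "spread a b (concat xs)"
  using assms by (induction xs) (auto intro: spread_append spread_without)

lemma spread_pair:
  assumes "a \<noteq> b"
  shows "spread a b [a, b]"
proof -
  have "count_list g a \<le> count_list g b + 1" if "sublist g [a, b]" for g
    using subseq_count_list_le[OF sublist_imp_subseq[OF that], of a] assms by simp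
  then show ?thesis
    using assms by (auto simp: spread_def suffix_Cons)
qed

lemma suffix_concat_replicateD:
  assumes "suffix u (concat (replicate T w))"
  shows "\<exists>w0 s0 j. w = w0 @ s0 \<and> u = s0 @ concat (replicate j w)"
  using assms
proof (induction T)
  case 0
  then show ?case
    by (auto intro: exI[of _ 0])
next
  case (Suc T)
  then consider "suffix u (concat (replicate T w))"
    | v where "u = v @ concat (replicate T w)" "suffix v w"
    by (auto simp: suffix_append)
  then show ?case
    using Suc.IH by cases (auto simp: suffix_def)
qed

text \<open>
  A factor \<open>g\<close> shorter than a period is completed to a rotation of \<open>w\<close>, and the complement
  has at most one more \<open>a\<close> than \<open>b\<close>.
\<close>
lemma factor_of_power_bound:
  assumes w: "spread a b w" "count_list w a = 2 * N" "count_list w b = 4 * N"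
    and g: "sublist g (concat (replicate T w))"
  shows "min (count_list g b) (4 * N) \<le> count_list g a + (2 * N + 1)"
proof -
  obtain u where u: "suffix u (concat (replicate T w))" "prefix g u"
    using g by (auto simp: sublist_def suffix_def prefix_def)
  obtain w0 s0 j where j: "w = w0 @ s0" "u = s0 @ concat (replicate j w)"
    using suffix_concat_replicateD[OF u(1)] by blast
  have "prefix g (s0 @ w0) \<or> prefix (s0 @ w0) g"
  proof (cases j)
    case 0
    then show ?thesis
      using u(2) j by (auto intro: prefix_order.trans)
  next
    case (Suc k)
    then have "prefix (s0 @ w0) u"
      by (simp add: j)
    then show ?thesis
      using u(2) prefix_same_cases by blast
  qed
  then show ?thesis
  proof
    assume "prefix (s0 @ w0) g"
    then have "count_list (s0 @ w0) a \<le> count_list g a"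
      by (intro subseq_count_list_le prefix_imp_subseq)
    then show ?thesis
      using w(2) by (simp add: j)
  next
    assume "prefix g (s0 @ w0)"
    then obtain g' where g': "s0 @ w0 = g @ g'"
      by (auto simp: prefix_def)
    have "w @ w = (w0 @ g) @ g' @ s0"
      using g' by (simp add: j(1))
    then have "sublist g' (w @ w)"
      by (metis sublist_appendI)
    then have "count_list g' a \<le> count_list g' b + 1"
      using spread_append[OF w(1) w(1)] by (simp add: spread_def)
    moreover have "count_list g a + count_list g' a = 2 * N" "count_list g b + count_list g' b = 4 * N"
      using arg_cong[OF g', of "\<lambda>x. count_list x a"] arg_cong[OF g', of "\<lambda>x. count_list x b"] w(2,3)
      by (simp_all add: j(1))
    ultimately show ?thesis
      by linarith
  qed
qed

text \<open>Let \<open>g\<close> be the stretch of \<open>x\<close> from which the run of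
  \<open>b\<close> in \<open>z\<close> is taken. Letters \<open>a\<close> inside \<open>g\<close>
  are lost, and the letters \<open>b\<close> won exceed this loss by at most
  \<open>d\<close>.\<close>

lemma common_subseq_column_le:
  assumes z: "subseq z (replicate i a @ replicate B b @ replicate k a)" "subseq z x"
    and x: "\<And>g. sublist g x \<Longrightarrow> min (count_list g b) B \<le> count_list g a + d"
  shows "length z \<le> count_list x a + d"
proof -
  obtain z1 z2 z3 where zs: "z = z1 @ z2 @ z3"
    and sub: "subseq z1 (replicate i a)" "subseq z2 (replicate B b)" "subseq z3 (replicate k a)"
    using z(1) by (auto elim!: subseq_appendE)
  obtain x1 x2 x3 where xs: "x = x1 @ x2 @ x3" "subseq z1 x1" "subseq z2 x2" "subseq z3 x3"
    using z(2) by (auto simp: zs dest!: list_emb_appendD)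
  have "length z1 \<le> count_list x1 a" "length z2 \<le> count_list x2 b" "length z3 \<le> count_list x3 a"
    using xs(2-4) subseq_of_replicate(1)[OF sub(1)] subseq_of_replicate(1)[OF sub(2)]
      subseq_of_replicate(1)[OF sub(3)] by (metis subseq_replicate_iff)+
  moreover have "length z2 \<le> B"
    using subseq_of_replicate(2)[OF sub(2)] .
  moreover have "min (count_list x2 b) B \<le> count_list x2 a + d"
    by (rule x) (simp add: xs(1))
  ultimately show ?thesis
    by (simp add: zs xs(1))
qed

text \<open>
  Passing from column \<open>k\<close> to column \<open>k + 1\<close> at a suffix \<open>u\<close> of \<open>w\<^sup>T\<close> costs nothing beyond
  the bound for a single copy of \<open>w\<close>, because \<open>u\<close> contains at most \<open>2 * N\<close> more letters
  \<open>za (k + 1)\<close> than letters \<open>za k\<close>.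
\<close>
lemma common_subseq_columns_le:
  fixes za on :: "nat \<Rightarrow> 'a"
  assumes w: "\<And>k. k < K \<Longrightarrow> spread (za k) (on k) w" "\<And>k. k < K \<Longrightarrow> count_list w (za k) = 2 * N"
      "\<And>k. k < K \<Longrightarrow> count_list w (on k) = 4 * N"
    and "k < K" "suffix u (concat (replicate T w))" "subseq z u"
      "subseq z (concat (map (\<lambda>k. replicate A (za k) @ replicate (4 * N) (on k) @ replicate A (za k)) [k..<K]))"
  shows "length z \<le> count_list u (za k) + (2 * N + 1) + (K - Suc k) * (4 * N + 1)"
  using assms(4-)
proof (induction "K - k" arbitrary: k u z)
  case (Suc d)
  let ?Y = "\<lambda>k. replicate A (za k) @ replicate (4 * N) (on k) @ replicate A (za k)"
  have "[k..<K] = k # [Suc k..<K]"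
    using Suc.prems(1) by (rule upt_conv_Cons)
  then obtain z1 z2 where z: "z = z1 @ z2" "subseq z1 (?Y k)" "subseq z2 (concat (map ?Y [Suc k..<K]))"
    using Suc.prems(4) by (auto simp del: append_assoc elim!: subseq_appendE[of z "?Y k"])
  obtain u1 u2 where u: "u = u1 @ u2" "subseq z1 u1" "subseq z2 u2"
    using Suc.prems(3) z(1) by (auto dest: list_emb_appendD)
  have u2: "suffix u2 (concat (replicate T w))"
    using Suc.prems(2) u(1) by (auto simp: suffix_def)
  have z1: "length z1 \<le> count_list u1 (za k) + (2 * N + 1)"
  proof (rule common_subseq_column_le[OF z(2) u(2)])
    fix g assume "sublist g u1"
    then have "sublist g (concat (replicate T w))"
      using Suc.prems(2) u(1) by (auto simp: suffix_def sublist_def) (metis append.assoc)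
    then show "min (count_list g (on k)) (4 * N) \<le> count_list g (za k) + (2 * N + 1)"
      using w Suc.prems(1) by (intro factor_of_power_bound) auto
  qed
  show ?case
  proof (cases "Suc k < K")
    case True
    have "length z2 \<le> count_list u2 (za (Suc k)) + (2 * N + 1) + (K - Suc (Suc k)) * (4 * N + 1)"
      using Suc.hyps(2) True u2 u(3) z(3) by (intro Suc.hyps(1)) auto
    moreover have "count_list u2 (za (Suc k)) \<le> count_list u2 (za k) + 2 * N"
    proof -
      obtain w0 s0 j where j: "w = w0 @ s0" "u2 = s0 @ concat (replicate j w)"
        using suffix_concat_replicateD[OF u2] by blast
      have cnt: "count_list (concat (replicate j w)) c = j * count_list w c" for c
        by (induction j) auto
      have "count_list s0 (za (Suc k)) \<le> 2 * N"
        using w(2)[OF True] by (simp add: j(1))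
      then show ?thesis
        using w(2)[OF True] w(2)[OF Suc.prems(1)] by (simp add: j(2) cnt)
    qed
    moreover have "(K - Suc k) * (4 * N + 1) = (K - Suc (Suc k)) * (4 * N + 1) + (4 * N + 1)"
      using True by (metis Suc_diff_Suc add.commute mult_Suc)
    ultimately show ?thesis
      using z1 by (simp add: z(1) u(1))
  next
    case False
    then have "z2 = []"
      using z(3) by simp
    then show ?thesis
      using z1 by (simp add: z(1) u(1))
  qed
qed simp

text \<open>If \<open>z\<close> uses a padding letter \<open>b\<close>, it ends in \<open>b\<close>
  and misses the final run \<open>replicate t a\<close>, so \<open>y\<close> limits its letters
  \<open>a\<close> and \<open>b\<close> to \<open>E\<close>. Otherwise the padding contributes at
  most its \<open>E\<close> letters \<open>a\<close>.\<close>

lemma common_subseq_padded_le: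
  assumes "a \<noteq> b" "count_list y a + count_list y b \<le> E"
    and base: "\<And>z. subseq z x \<Longrightarrow> subseq z (y @ replicate t a) \<Longrightarrow> length z \<le> L"
    and z: "subseq z (x @ replicate E a @ replicate F b)" "subseq z (y @ replicate t a)"
  shows "length z \<le> L + E"
proof -
  obtain z1 z2 z3 where zs: "z = z1 @ z2 @ z3"
    and sub: "subseq z1 x" "subseq z2 (replicate E a)" "subseq z3 (replicate F b)"
    using z(1) by (auto elim!: subseq_appendE)
  have "subseq z1 z"
    by (simp add: zs list_emb_prefix)
  then have "length z1 \<le> L"
    using base sub(1) z(2) by (metis subseq_order.trans)
  moreover have "length z2 + length z3 \<le> E"
  proof (cases "z3 = []")
    case True
    then show ?thesis
      using subseq_of_replicate(2)[OF sub(2)] by simp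
  next
    case False
    obtain y1 y2 where ys: "z = y1 @ y2" "subseq y1 y" "subseq y2 (replicate t a)"
      using z(2) by (auto elim!: subseq_appendE)
    have "y2 = []"
    proof (rule ccontr)
      assume "y2 \<noteq> []"
      then have "last z = a"
        using ys(1) subsetD[OF subseq_imp_subset[OF ys(3)] last_in_set[of y2]] by simp
      moreover have "last z = b"
        using False subsetD[OF subseq_imp_subset[OF sub(3)] last_in_set[of z3]] by (simp add: zs)
      ultimately show False
        using assms(1) by simp
    qed
    then have "count_list z a + count_list z b \<le> E"
      using ys subseq_count_list_le[of z y a] subseq_count_list_le[of z y b] assms(2) by simp
    moreover have "length z2 = count_list z2 a"
      using subseq_of_replicate(1)[OF sub(2)] by (metis count_list_replicate)
    moreover have "length z3 = count_list z3 b"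
      using subseq_of_replicate(1)[OF sub(3)] by (metis count_list_replicate)
    ultimately show ?thesis
      by (simp add: zs)
  qed
  ultimately show ?thesis
    by (simp add: zs)
qed

section \<open>Words that encode bits, and their common subsequences\<close>

definition block :: "'a \<Rightarrow> 'a \<Rightarrow> nat \<Rightarrow> 'a list" where
  "block a b v = (if v = 0 then [a, b] @ [a, b] @ [b, b] else [b, b] @ [a, b] @ [a, b])"

text \<open>Both kinds of block have two \<open>a\<close> and four \<open>b\<close>, so letter
  counts reveal nothing about \<open>f\<close>. The fixed leading block makes every word begin with
  \<open>a\<close>, which the baseline matching needs.\<close>

definition column_word :: "'a \<Rightarrow> 'a \<Rightarrow> nat \<Rightarrow> (nat \<Rightarrow> nat) \<Rightarrow> 'a list" where
  "column_word a b N f = block a b 0 @ concat (map (\<lambda>i. block a b (f i)) [0..<N])"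

lemma length_blocks: "length (concat (map (\<lambda>i. block a b (f i)) I)) = 6 * length I"
  by (induction I) (auto simp: block_def)

lemma count_list_blocks:
  assumes "a \<noteq> b"
  shows "count_list (concat (map (\<lambda>i. block a b (f i)) I)) a = 2 * length I"
    "count_list (concat (map (\<lambda>i. block a b (f i)) I)) b = 4 * length I"
  using assms by (induction I) (auto simp: block_def)

lemma length_column_word: "length (column_word a b N f) = 6 * Suc N"
  by (simp add: column_word_def length_blocks) (simp add: block_def)

lemma count_list_column_word:
  assumes "a \<noteq> b"
  shows "count_list (column_word a b N f) a = 2 * Suc N"
    "count_list (column_word a b N f) b = 4 * Suc N"
  using assms by (simp_all add: column_word_def count_list_blocks) (simp_all add: block_def)

lemma set_column_word: "set (column_word a b N f) \<subseteq> {a, b}"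
  by (auto simp: column_word_def block_def split: if_splits)

lemma spread_column_word:
  assumes "a \<noteq> b"
  shows "spread a b (column_word a b N f)"
proof -
  have "spread a b (block a b v)" for v
    using assms spread_pair[OF assms] spread_without[of a "[b, b]" b]
    unfolding block_def by (auto intro!: spread_append simp del: append.simps)
  then show ?thesis
    unfolding column_word_def by (auto intro!: spread_append spread_concat)
qed

text \<open>Take the initial \<open>a\<close>, then all \<open>b\<close> of the first word, then all
  \<open>a\<close> of the second. This baseline serves the columns in which no exchange is
  available.\<close>

lemma column_words_common_subseq:
  assumes "a \<noteq> b"
  obtains c where "subseq c (column_word a b N f @ column_word a b N f')"
    "subseq c (replicate (4 * Suc N) a @ replicate (4 * Suc N) b @ replicate (4 * Suc N) a)"
    "length c = 6 * Suc N + 1"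
proof
  let ?c = "[a] @ replicate (4 * Suc N) b @ replicate (2 * Suc N) a"
  let ?r = "tl (column_word a b N f)"
  have w: "column_word a b N f = [a] @ ?r"
    by (simp add: column_word_def block_def)
  have "count_list ?r b = 4 * Suc N"
    using count_list_column_word(2)[OF assms, of N f] assms by (subst (asm) w) simp
  then have "subseq (replicate (4 * Suc N) b) ?r"
    by (simp add: subseq_replicate_iff)
  moreover have "subseq (replicate (2 * Suc N) a) (column_word a b N f')"
    unfolding subseq_replicate_iff by (simp add: count_list_column_word[OF assms])
  ultimately have "subseq ?c (([a] @ ?r) @ column_word a b N f')"
    unfolding append_assoc by (intro list_emb_append_mono) auto
  then show "subseq ?c (column_word a b N f @ column_word a b N f')"
    by (simp only: w[symmetric])
  have "subseq (replicate 1 a) (replicate (4 * Suc N) a)"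
      "subseq (replicate (2 * Suc N) a) (replicate (4 * Suc N) a)"
    unfolding subseq_replicate_iff count_list_replicate by auto
  then show "subseq ?c (replicate (4 * Suc N) a @ replicate (4 * Suc N) b @ replicate (4 * Suc N) a)"
    by (intro list_emb_append_mono) auto
  show "length ?c = 6 * Suc N + 1"
    by simp
qed

text \<open>
  The \<open>b\<close>s are taken from the last three \<open>b\<close>s of block \<open>i\<close> of the first word up to the first \<open>b\<close>
  of block \<open>i\<close> of the second word; this stretch contains \<open>2 * N\<close> letters \<open>a\<close> only, where a
  stretch of a periodic word with as many \<open>b\<close>s contains at least \<open>2 * N + 1\<close>.
\<close>
lemma column_words_common_subseq_gain:
  assumes "a \<noteq> b" "i < N" "f i = 0" "f' i \<noteq> 0"
  obtains c where "subseq c (column_word a b N f @ column_word a b N f')"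
    "subseq c (replicate (4 * Suc N) a @ replicate (4 * Suc N) b @ replicate (4 * Suc N) a)"
    "length c = 6 * Suc N + 2"
proof
  \<comment> \<open>Before the stretch lie the letters \<open>a\<close> of the leading block and of
    blocks \<open>0\<close> to \<open>i\<close>, since block \<open>i\<close> of the first word has
    both ahead of its last three \<open>b\<close>; after it lie those of blocks \<open>i\<close> to
    \<open>N - 1\<close> of the second word.\<close>
  let ?c = "replicate (2 * i + 4) a @ replicate (4 * Suc N) b @ replicate (2 * (N - i)) a"
  let ?B = "\<lambda>f I. concat (map (\<lambda>i. block a b (f i)) I)"
  have split: "[0..<N] = [0..<i] @ i # [Suc i..<N]"
    using assms(2) upt_add_eq_append[of 0 i "N - i"] by (simp add: upt_conv_Cons)
  have w: "column_word a b N f =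
      (block a b 0 @ ?B f [0..<i] @ [a, b, a]) @ ([b, b, b] @ ?B f [Suc i..<N])"
    unfolding column_word_def split by (simp add: assms(3)) (simp add: block_def)
  have w': "column_word a b N f' =
      (block a b 0 @ ?B f' [0..<i] @ [b]) @ ([b, a, b, a, b] @ ?B f' [Suc i..<N])"
    unfolding column_word_def split by (simp add: assms(4)) (simp add: block_def assms(4))
  let ?u = "([b, b, b] @ ?B f [Suc i..<N]) @ (block a b 0 @ ?B f' [0..<i] @ [b])"
  have c1: "subseq (replicate (2 * i + 4) a) (block a b 0 @ ?B f [0..<i] @ [a, b, a])"
    using assms(1) by (simp add: subseq_replicate_iff count_list_blocks) (simp add: block_def)
  have c2: "subseq (replicate (4 * Suc N) b) ?u"
    using assms(1,2) unfolding subseq_replicate_iff by (simp add: count_list_blocks) (simp add: block_def)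
  have c3: "subseq (replicate (2 * (N - i)) a) ([b, a, b, a, b] @ ?B f' [Suc i..<N])"
    using assms(1,2) unfolding subseq_replicate_iff by (simp add: count_list_blocks)
  have "subseq ?c ((block a b 0 @ ?B f [0..<i] @ [a, b, a]) @ ?u @ ([b, a, b, a, b] @ ?B f' [Suc i..<N]))"
    by (intro list_emb_append_mono c1 c2 c3)
  then show "subseq ?c (column_word a b N f @ column_word a b N f')"
    unfolding w w' by simp
  have "subseq (replicate (2 * i + 4) a) (replicate (4 * Suc N) a)"
      "subseq (replicate (2 * (N - i)) a) (replicate (4 * Suc N) a)"
    using assms(2) unfolding subseq_replicate_iff count_list_replicate by auto
  then show "subseq ?c (replicate (4 * Suc N) a @ replicate (4 * Suc N) b @ replicate (4 * Suc N) a)"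
    by (intro list_emb_append_mono) auto
  show "length ?c = 6 * Suc N + 2"
    using assms(2) by simp
qed

section \<open>Small approximation factors: the lower bound\<close>

lemma subseq_replicate_concat:
  assumes "\<And>e. e \<in> set I \<Longrightarrow> subseq (replicate m c) (f e)"
  shows "subseq (replicate (m * length I) c) (concat (map f I))"
  using assms by (induction I) (auto simp: replicate_add intro: list_emb_append_mono)

text \<open>
  Column \<open>k\<close> of \<open>y\<close> is matched with the blocks of column \<open>k\<close> in the windows \<open>2 * (a + k)\<close>,
  \<open>2 * (a + k) + 1\<close> and \<open>2 * (a + k) + 2\<close>; the last of these windows is shared with column \<open>k + 1\<close>.
\<close>
lemma subseq_staircase:
  fixes bl :: "nat \<Rightarrow> nat \<Rightarrow> 'a list"
  assumes K: "0 < K" and T: "2 * (a + K) < T"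
    and zeros: "\<And>e k. k < K \<Longrightarrow> subseq (replicate m (za k)) (bl e k)"
    and c: "\<And>k. k < K \<Longrightarrow> subseq (c k) (bl (2 * (a + k)) k @ bl (Suc (2 * (a + k))) k)"
  shows "subseq (replicate (m * (2 * a)) (za 0)
      @ concat (map (\<lambda>k. c k @ replicate m (za k)) [0..<K])
      @ replicate (m * (T - Suc (2 * (a + K)))) (za (K - 1)))
    (concat (map (\<lambda>e. concat (map (bl e) [0..<K])) [0..<T]))"
proof -
  define wd where "wd e = concat (map (bl e) [0..<K])" for e
  \<comment> \<open>\<open>X k\<close> is the part of the input left for columns \<open>k\<close>
    onwards. The induction runs downwards from \<open>K\<close>, where only the final run
    \<open>t\<close> remains to be matched.\<close>
  define X where "X k = concat (map (bl (2 * (a + k))) [k..<K]) @ concat (map wd [Suc (2 * (a + k))..<T])" for k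
  define t where "t = replicate (m * (T - Suc (2 * (a + K)))) (za (K - 1))"
  have bl_wd: "subseq (bl e k) (wd e)" if "k < K" for e k
  proof -
    have "[0..<K] = [0..<k] @ k # [Suc k..<K]"
      using that upt_add_eq_append[of 0 k "K - k"] by (simp add: upt_conv_Cons)
    then show ?thesis
      by (auto simp: wd_def)
  qed
  have zwd: "subseq (replicate m (za k)) (wd e)" if "k < K" for k e
    using zeros[OF that] bl_wd[OF that] by (meson subseq_order.trans)
  have X: "subseq (concat (map (\<lambda>k. c k @ replicate m (za k)) [k..<K]) @ t) (X k)" if "k \<le> K" for k
    using that
  proof (induction k rule: inc_induct)
    case base
    have "subseq (replicate (m * length [Suc (2 * (a + K))..<T]) (za (K - 1)))
        (concat (map wd [Suc (2 * (a + K))..<T]))"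
      by (rule subseq_replicate_concat) (use K zwd in auto)
    then show ?case
      by (simp add: X_def t_def)
  next
    case (step k)
    define e where "e = 2 * (a + k)"
    have k: "k < K"
      using step by simp
    have e: "Suc (Suc e) < T" "2 * (a + Suc k) = Suc (Suc e)"
      using k T by (auto simp: e_def)
    have "[0..<K] = [0..<k] @ k # [Suc k..<K]"
      using k upt_add_eq_append[of 0 k "K - k"] by (simp add: upt_conv_Cons)
    then have wd2: "wd (Suc (Suc e)) = concat (map (bl (Suc (Suc e))) [0..<k]) @ bl (Suc (Suc e)) k
        @ concat (map (bl (Suc (Suc e))) [Suc k..<K])"
      by (simp add: wd_def)
    have "X k = (bl e k @ concat (map (bl e) [Suc k..<K])) @ wd (Suc e) @ wd (Suc (Suc e))
        @ concat (map wd [Suc (Suc (Suc e))..<T])"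
      using k e by (simp add: X_def e_def[symmetric] upt_conv_Cons)
    also have "\<dots> = (bl e k @ concat (map (bl e) [Suc k..<K])) @ wd (Suc e)
        @ (concat (map (bl (Suc (Suc e))) [0..<k]) @ bl (Suc (Suc e)) k) @ X (Suc k)"
      by (simp only: wd2 X_def e(2) append_assoc)
    finally have Xk: "X k = \<dots>" .
    have "subseq ((bl e k @ bl (Suc e) k) @ replicate m (za k) @
        (concat (map (\<lambda>k. c k @ replicate m (za k)) [Suc k..<K]) @ t)) (X k)"
      unfolding Xk append_assoc[of "bl e k" "bl (Suc e) k"]
      by (subst append_assoc[symmetric], subst append_assoc[symmetric],
          intro list_emb_append_mono list_emb_append2 list_emb_prefix step.IH bl_wd zeros k
            subseq_order.order_refl)
    moreover have "subseq (c k @ replicate m (za k) @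
        (concat (map (\<lambda>k. c k @ replicate m (za k)) [Suc k..<K]) @ t))
      ((bl e k @ bl (Suc e) k) @ replicate m (za k) @
        (concat (map (\<lambda>k. c k @ replicate m (za k)) [Suc k..<K]) @ t))"
      using c[OF k] by (intro list_emb_append_mono) (auto simp: e_def)
    ultimately have "subseq (c k @ replicate m (za k) @
        (concat (map (\<lambda>k. c k @ replicate m (za k)) [Suc k..<K]) @ t)) (X k)"
      by (meson subseq_order.trans)
    then show ?case
      using k by (simp add: upt_conv_Cons)
  qed
  have "subseq (replicate (m * (2 * a)) (za 0)) (concat (map wd [0..<2 * a]))"
    using subseq_replicate_concat[of "[0..<2 * a]" m "za 0" wd] zwd[OF K] by simp
  moreover have "concat (map wd [0..<T]) = concat (map wd [0..<2 * a]) @ X 0"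
  proof -
    have "[0..<T] = [0..<2 * a] @ 2 * a # [Suc (2 * a)..<T]"
      using T upt_add_eq_append[of 0 "2 * a" "T - 2 * a"] by (simp add: upt_conv_Cons)
    then show ?thesis
      by (simp add: X_def wd_def[symmetric])
  qed
  ultimately have "subseq (replicate (m * (2 * a)) (za 0)
      @ (concat (map (\<lambda>k. c k @ replicate m (za k)) [0..<K]) @ t)) (concat (map wd [0..<T]))"
    using X[of 0] by (simp only: list_emb_append_mono)
  then show ?thesis
    by (simp add: t_def wd_def[abs_def])
qed

lemma subseq_replicate_mono: "m \<le> n \<Longrightarrow> subseq (replicate m c) (replicate n c)"
  by (simp add: subseq_replicate_iff count_list_replicate)

lemma sum_pairs: "(\<Sum>j<n. f (2 * j) + f (Suc (2 * j))) = (\<Sum>e<2 * n. f e :: nat)"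
  by (induction n) auto

lemma sum_blocks:
  fixes f :: "nat \<Rightarrow> nat"
  shows "(\<Sum>k<K. \<Sum>i<N. f (k * N + i)) = (\<Sum>c<K * N. f c)"
proof -
  have "(\<Sum>i<N. f (k * N + i)) = sum f {k * N..<k * N + N}" for k
    using sum.shift_bounds_nat_ivl[of f 0 "k * N" N]
    by (simp add: atLeast0LessThan add.commute)
  then show ?thesis
    by (simp add: sum.nat_group)
qed

text \<open>Repetitive inputs have \<open>LCS\<close> at most \<open>L0 + E\<close>. Under the
  contrary assumption, a hybrid input gains one letter in each good column of a diagonal, at least
  \<open>K / 2\<close> in total, whereas the approximation guarantee leaves room for
  \<open>\<epsilon> * (L0 + E) < K / 2\<close> only.\<close>

lemma space_bound_small_eps:
  assumes \<Sigma>: "finite \<Sigma>" "2 * K \<le> card \<Sigma>"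
    and A: "makes_passes A \<Sigma> n R" "computes_LCS_approx A \<Sigma> n \<epsilon>" "uses_space A \<Sigma> n s"
    and \<epsilon>: "0 < \<epsilon>" and K: "0 < K" and N': "0 < N'" and small: "50 * \<epsilon> * real (Suc N') < 1"
    and n: "40 * (K * K * Suc N') \<le> n"
  shows "K * N' < 48 * R * Suc s"
proof (rule ccontr)
  assume "\<not> K * N' < 48 * R * Suc s"
  then have big: "48 * R * Suc s \<le> K * N'"
    by simp
  define N where "N = Suc N'"
  \<comment> \<open>The windows form \<open>2 * K\<close> pairs, the number of rows that
    \<open>exists_good_diagonal\<close> needs for \<open>K\<close> columns.\<close>
  define T where "T = 4 * K"
  \<comment> \<open>\<open>E\<close> is at least the number of letters \<open>za k1\<close> and
    \<open>on k1\<close> in \<open>y\<close> before its final run. So the padding of the input adds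
    at most \<open>E\<close> to the upper bound, and the hybrid input attains this
    \<open>E\<close>.\<close>
  define E where "E = 12 * N * K"
  define k1 where "k1 = K - 1"
  have Kk1: "K = Suc k1"
    using K by (simp add: k1_def)
  have NK: "N * K \<le> K * K * N"
    using K by (simp add: mult.commute)
  obtain lt where lt: "bij_betw lt {..<card \<Sigma>} \<Sigma>"
    using ex_bij_betw_nat_finite[OF \<Sigma>(1)] by (auto simp: atLeast0LessThan)
  define za where "za k = lt (2 * k)" for k
  define on where "on k = lt (Suc (2 * k))" for k
  have mem: "za k \<in> \<Sigma>" "on k \<in> \<Sigma>" if "k < K" for k
    using that \<Sigma>(2) bij_betwE[OF lt] by (auto simp: za_def on_def)
  have lt_inj: "lt i = lt j \<longleftrightarrow> i = j" if "i < 2 * K" "j < 2 * K" for i j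
    using that \<Sigma>(2) lt by (auto simp: bij_betw_def inj_on_def)
  have ne: "za k \<noteq> on k'" "on k \<noteq> za k'" "za k = za k' \<longleftrightarrow> k = k'" "on k = on k' \<longleftrightarrow> k = k'"
    if "k < K" "k' < K" for k k'
  proof -
    have "2 * k \<noteq> Suc (2 * k')" "Suc (2 * k) \<noteq> 2 * k'"
      by presburger+
    then show "za k \<noteq> on k'" "on k \<noteq> za k'" "za k = za k' \<longleftrightarrow> k = k'" "on k = on k' \<longleftrightarrow> k = k'"
      using that by (auto simp: za_def on_def lt_inj)
  qed
  define bl where "bl p k = column_word (za k) (on k) N' (\<lambda>i. p (k * N' + i))" for p :: "nat \<Rightarrow> nat" and k
  define g where "g p = concat (map (bl p) [0..<K])" for p
  define F where "F = n - (T * (K * (6 * N)) + E)"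
  define pad where "pad = replicate E (za k1) @ replicate F (on k1)"
  \<comment> \<open>The first run has room, in column 0, for the \<open>2 * a\<close> windows before
    the diagonal at \<open>2 * N\<close> letters each; the last run holds \<open>4 * N\<close>
    letters for the match \<open>c k\<close> and \<open>2 * N\<close> from the window shared with
    the next column.\<close>
  define piece where "piece k = replicate (4 * N * K) (za k) @ replicate (4 * N) (on k) @ replicate (6 * N) (za k)" for k
  define y0 where "y0 = concat (map piece [0..<K])"
  define t where "t = n - length y0"
  define y where "y = y0 @ replicate t (za k1)"

  have y0len: "length y0 = K * (4 * N * K + 10 * N)"
    unfolding y0_def by (subst length_concat_windows) (auto simp: piece_def)
  have n40: "40 * (K * K * N) \<le> n"
    using n by (simp add: N_def)
  have "T * (K * (6 * N)) = 24 * (K * K * N)"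
    by (simp add: T_def)
  then have xlen: "T * (K * (6 * N)) + E \<le> n"
    using n40 NK unfolding E_def by linarith
  have "length y0 = 4 * (K * K * N) + 10 * (N * K)"
    by (simp add: y0len algebra_simps)
  then have tlen: "8 * N * K + E \<le> t" and y0n: "length y0 \<le> n"
    using n40 NK unfolding E_def t_def by linarith+
  have y: "y \<in> words \<Sigma> n"
    using mem Kk1 y0n by (auto simp: words_def y_def t_def y0_def piece_def set_replicate_conv_if split: if_splits)
  have l: "0 < K * (6 * N)"
    using K by (simp add: N_def)
  have glen: "length (g p) = K * (6 * N)" for p
    unfolding g_def by (subst length_concat_windows) (auto simp: bl_def length_column_word N_def)
  have gset: "set (g p) \<subseteq> \<Sigma>" for p
    using mem set_column_word by (fastforce simp: g_def bl_def)
  have padset: "set pad \<subseteq> \<Sigma>"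
    using mem Kk1 by (auto simp: pad_def)
  have padlen: "T * (K * (6 * N)) + length pad = n"
    using xlen by (simp add: pad_def F_def)

  have cbl: "count_list (bl p k) (za j) = (if k = j then 2 * N else 0)"
      "count_list (bl p k) (on j) = (if k = j then 4 * N else 0)" if "k < K" "j < K" for p k j
  proof -
    have "za j \<notin> set (bl p k)" "on j \<notin> set (bl p k)" if "k \<noteq> j"
      using set_column_word[of "za k" "on k"] ne[OF \<open>k < K\<close> \<open>j < K\<close>] that by (force simp: bl_def)+
    then show "count_list (bl p k) (za j) = (if k = j then 2 * N else 0)"
        "count_list (bl p k) (on j) = (if k = j then 4 * N else 0)"
      using that ne(1)[of j j] by (auto simp: bl_def count_list_column_word N_def)
  qed
  have cg: "count_list (concat (map f [0..<k])) x = (\<Sum>i<k. count_list (f i) x)"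
    for f :: "nat \<Rightarrow> 'a list" and x k
    by (induction k) auto
  have wza: "count_list (g p) (za k) = 2 * N" and won: "count_list (g p) (on k) = 4 * N" if "k < K" for p k
    using that cbl by (simp_all add: g_def cg)
  have spr: "spread (za k) (on k) (g p)" if "k < K" for p k
    unfolding g_def
  proof (rule spread_concat)
    fix x assume "x \<in> set (map (bl p) [0..<K])"
    then obtain j where j: "x = bl p j" "j < K"
      by auto
    show "spread (za k) (on k) x"
    proof (cases "j = k")
      case True
      then show ?thesis
        using j spread_column_word ne(1)[OF that that] by (simp add: bl_def)
    next
      case False
      then have "za k \<notin> set x"
        using j cbl(1)[of j k p] that by (simp add: count_list_0_iff)
      then show ?thesis
        by (rule spread_without)
    qed
  qed
  define L0 where "L0 = T * (2 * N) + (2 * N + 1) + (K - 1) * (4 * N + 1)"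
  have L: "LCS (concat (map (\<lambda>e. g p) [0..<T]) @ pad) y \<le> L0 + E" for p
  proof (rule LCS_le)
    fix z assume z: "subseq z (concat (map (\<lambda>e. g p) [0..<T]) @ pad)" "subseq z y"
    have rep: "map (\<lambda>e. g p) [0..<T] = replicate T (g p)"
      by (simp add: map_replicate_const)
    define y1 where "y1 = concat (map piece [0..<k1]) @ replicate (4 * N * K) (za k1) @ replicate (4 * N) (on k1)"
    have yy: "y = y1 @ replicate (6 * N + t) (za k1)"
      by (simp add: y_def y1_def y0_def Kk1 piece_def replicate_add)
    have "count_list (piece i) (za k1) = 0" "count_list (piece i) (on k1) = 0" if "i < k1" for i
      using that ne[of i k1] Kk1 by (auto simp: piece_def count_list_replicate)
    then have "count_list y1 (za k1) + count_list y1 (on k1) = 4 * N * K + 4 * N"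
      using ne[of k1 k1] Kk1 by (simp add: y1_def cg count_list_replicate)
    also have "\<dots> \<le> E"
      using K by (simp add: E_def)
    finally have cnt: "count_list y1 (za k1) + count_list y1 (on k1) \<le> E" .
    show "length z \<le> L0 + E"
    proof (rule common_subseq_padded_le[of "za k1" "on k1" y1 E])
      show "za k1 \<noteq> on k1"
        using ne(1) Kk1 by simp
      show "count_list y1 (za k1) + count_list y1 (on k1) \<le> E"
        by (rule cnt)
      show "subseq z (concat (replicate T (g p)) @ replicate E (za k1) @ replicate F (on k1))"
        using z(1) by (simp add: rep pad_def)
      show "subseq z (y1 @ replicate (6 * N + t) (za k1))"
        using z(2) by (simp add: yy)
    next
      fix v assume v: "subseq v (concat (replicate T (g p)))" "subseq v (y1 @ replicate (6 * N + t) (za k1))"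
      \<comment> \<open>Lengthening all runs of \<open>za k\<close> to the common length
        \<open>Af\<close> only helps common subsequences and gives \<open>y\<close> the shape
        required by \<open>common_subseq_columns_le\<close>.\<close>
      define Af where "Af = 4 * N * K + 6 * N + t"
      define Y where "Y k = replicate Af (za k) @ replicate (4 * N) (on k) @ replicate Af (za k)" for k
      have "subseq (piece k) (Y k)" for k
        unfolding piece_def Y_def
        by (intro list_emb_append_mono subseq_replicate_mono) (auto simp: Af_def)
      then have "subseq (concat (map piece [0..<k1])) (concat (map Y [0..<k1]))"
        by (intro subseq_concat_map)
      moreover have "subseq (replicate (4 * N * K) (za k1) @ replicate (4 * N) (on k1) @ replicate (6 * N + t) (za k1)) (Y k1)"
        unfolding Y_def by (intro list_emb_append_mono subseq_replicate_mono) (auto simp: Af_def)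
      ultimately have "subseq (y1 @ replicate (6 * N + t) (za k1)) (concat (map Y [0..<k1]) @ Y k1)"
        unfolding y1_def append_assoc by (rule list_emb_append_mono)
      then have "subseq v (concat (map Y [0..<K]))"
        using v(2) by (simp add: Kk1)
      then have "length v \<le> count_list (concat (replicate T (g p))) (za 0) + (2 * N + 1) + (K - Suc 0) * (4 * N + 1)"
        using v(1) unfolding Y_def
        by (intro common_subseq_columns_le[where w = "g p" and on = on and T = T and A = Af])
          (auto simp: spr wza won K)
      moreover have "count_list (concat (replicate T (g p))) c = T * count_list (g p) c" for c
        by (induction T) auto
      ultimately show "length v \<le> L0"
        by (simp add: L0_def wza K)
    qed
  qed

  obtain U where U: "\<And>e. U e \<subseteq> {..<K * N'} \<rightarrow>\<^sub>E {..<2}" "\<And>e. U e \<noteq> {}"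
    and miss: "(\<Sum>e<T. \<Sum>c<K * N'. 2 - card ((\<lambda>p. p c) ` U e)) \<le> 3 * R * Suc s * T * 2"
    and hyb: "\<forall>q. (\<forall>e. q e \<in> U e) \<longrightarrow>
      real (LCS (concat (map (\<lambda>e. g (q e)) [0..<T]) @ pad) y) \<le> (1 + \<epsilon>) * real (L0 + E)"
    by (rule exchangeable_windows[where g = g and M = "K * N'" and W = 2 and L = "L0 + E",
          OF A \<epsilon> y l _ glen gset padset padlen L]) (simp, rule that)
  define m where "m e c = 2 - card ((\<lambda>p. p c) ` U e)" for e c
  \<comment> \<open>A cell is good if some block of column \<open>k\<close> can be 0 in the first
    and 1 in the second window of pair \<open>j\<close>. A bad cell misses at least
    \<open>N'\<close> values, one for each block.\<close>
  define good where "good j k \<longleftrightarrow> (\<exists>i<N'. 0 \<in> (\<lambda>p. p (k * N' + i)) ` U (2 * j)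
    \<and> 1 \<in> (\<lambda>p. p (k * N' + i)) ` U (Suc (2 * j)))" for j k
  define f where "f j k = (if good j k then 0 else 1 :: nat)" for j k
  have missing: "1 \<le> m e c" if "v \<notin> (\<lambda>p. p c) ` U e" "v < 2" "c < K * N'" for e c v
  proof -
    have "(\<lambda>p. p c) ` U e \<subseteq> {..<2} - {v}"
      using U(1)[of e] that by (auto simp: PiE_def Pi_def)
    then have "card ((\<lambda>p. p c) ` U e) \<le> card ({..<2} - {v})"
      by (intro card_mono) auto
    then show ?thesis
      using that(2) by (simp add: m_def)
  qed
  have fm: "N' * f j k \<le> (\<Sum>i<N'. m (2 * j) (k * N' + i) + m (Suc (2 * j)) (k * N' + i))" if "k < K" for j k
  proof (cases "good j k")
    case False
    have "1 \<le> m (2 * j) (k * N' + i) + m (Suc (2 * j)) (k * N' + i)" if "i < N'" for i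
    proof -
      have "k * N' + i < Suc k * N'"
        using that by simp
      also have "\<dots> \<le> K * N'"
        using \<open>k < K\<close> by (intro mult_right_mono) auto
      finally have c: "k * N' + i < K * N'" .
      have "0 \<notin> (\<lambda>p. p (k * N' + i)) ` U (2 * j) \<or> 1 \<notin> (\<lambda>p. p (k * N' + i)) ` U (Suc (2 * j))"
        using False that by (auto simp: good_def)
      then show ?thesis
        using missing[of 0 "k * N' + i" "2 * j"] missing[of 1 "k * N' + i" "Suc (2 * j)"] c by fastforce
    qed
    then have "(\<Sum>i<N'. 1) \<le> (\<Sum>i<N'. m (2 * j) (k * N' + i) + m (Suc (2 * j)) (k * N' + i))"
      by (intro sum_mono) auto
    then show ?thesis
      using False by (simp add: f_def)
  qed (simp add: f_def)
  have "N' * (\<Sum>j<2 * K. \<Sum>k<K. f j k) = (\<Sum>j<2 * K. \<Sum>k<K. N' * f j k)"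
    by (simp add: sum_distrib_left)
  also have "\<dots> \<le> (\<Sum>j<2 * K. \<Sum>k<K. \<Sum>i<N'. m (2 * j) (k * N' + i) + m (Suc (2 * j)) (k * N' + i))"
    by (intro sum_mono) (use fm in auto)
  also have "\<dots> = (\<Sum>j<2 * K. (\<Sum>c<K * N'. m (2 * j) c) + (\<Sum>c<K * N'. m (Suc (2 * j)) c))"
    by (simp only: sum.distrib sum_blocks)
  also have "\<dots> = (\<Sum>e<T. \<Sum>c<K * N'. m e c)"
    by (simp only: sum_pairs[of "\<lambda>e. \<Sum>c<K * N'. m e c"]) (simp add: T_def)
  also have "\<dots> \<le> 24 * (R * Suc s) * K"
    using miss by (simp add: m_def T_def algebra_simps)
  finally have tot: "N' * (\<Sum>j<2 * K. \<Sum>k<K. f j k) \<le> 24 * (R * Suc s) * K" .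
  obtain a where a: "a < K" "K * (\<Sum>k<K. f (a + k) k) \<le> (\<Sum>j<2 * K. \<Sum>k<K. f j k)"
    using exists_good_diagonal[OF K] by blast
  define b where "b = (\<Sum>k<K. f (a + k) k)"
  have "K * (N' * b) \<le> N' * (\<Sum>j<2 * K. \<Sum>k<K. f j k)"
    using a(2) by (metis b_def mult.left_commute mult_le_mono2)
  also have "\<dots> \<le> K * (24 * (R * Suc s))"
    using tot by (simp only: mult.commute)
  finally have "N' * b \<le> 24 * (R * Suc s)"
    using K by (metis mult_le_cancel1)
  then have "2 * (N' * b) \<le> 48 * R * Suc s"
    by simp
  then have "2 * (N' * b) \<le> K * N'"
    using big by (rule order_trans)
  then have "N' * (2 * b) \<le> N' * K"
    by (simp only: mult.left_commute mult.commute[of K])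
  then have b: "2 * b \<le> K"
    using N' by (metis mult_le_cancel1)

  have "\<exists>i. good (a + k) k \<longrightarrow> i < N' \<and> 0 \<in> (\<lambda>p. p (k * N' + i)) ` U (2 * (a + k))
      \<and> 1 \<in> (\<lambda>p. p (k * N' + i)) ` U (Suc (2 * (a + k)))" for k
    by (auto simp: good_def)
  then obtain ix where ix: "\<And>k. good (a + k) k \<Longrightarrow> ix k < N' \<and> 0 \<in> (\<lambda>p. p (k * N' + ix k)) ` U (2 * (a + k))
      \<and> 1 \<in> (\<lambda>p. p (k * N' + ix k)) ` U (Suc (2 * (a + k)))"
    by metis
  \<comment> \<open>The windows \<open>2 * (a + k)\<close> and \<open>2 * (a + k) + 1\<close> belong
    to one \<open>k\<close> only, so at most one coordinate per window is prescribed.\<close>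
  have "\<exists>p. p \<in> U e \<and> (\<forall>k. good (a + k) k \<longrightarrow> (e = 2 * (a + k) \<longrightarrow> p (k * N' + ix k) = 0)
      \<and> (e = Suc (2 * (a + k)) \<longrightarrow> p (k * N' + ix k) = 1))" for e
  proof (cases "\<exists>k. good (a + k) k \<and> (e = 2 * (a + k) \<or> e = Suc (2 * (a + k)))")
    case True
    then obtain k where k: "good (a + k) k" "e = 2 * (a + k) \<or> e = Suc (2 * (a + k))"
      by blast
    have uniq: "k' = k" if "e = 2 * (a + k') \<or> e = Suc (2 * (a + k'))" for k'
      using that k(2) by presburger
    have par: "2 * (a + k) \<noteq> Suc (2 * (a + k))"
      by presburger
    obtain p where "p \<in> U e" "p (k * N' + ix k) = (if e = 2 * (a + k) then 0 else 1)"
      using ix[OF k(1)] k(2) by (auto split: if_splits)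
    then show ?thesis
      using uniq par by (metis (full_types))
  qed (use U(2)[of e] in auto)
  then obtain q where q: "\<And>e. q e \<in> U e"
      "\<And>k. good (a + k) k \<Longrightarrow> q (2 * (a + k)) (k * N' + ix k) = 0"
      "\<And>k. good (a + k) k \<Longrightarrow> q (Suc (2 * (a + k))) (k * N' + ix k) = 1"
    by metis
  have "\<exists>c. subseq c (bl (q (2 * (a + k))) k @ bl (q (Suc (2 * (a + k)))) k)
      \<and> subseq c (replicate (4 * N) (za k) @ replicate (4 * N) (on k) @ replicate (4 * N) (za k))
      \<and> length c = 6 * N + 2 - f (a + k) k" if "k < K" for k
  proof (cases "good (a + k) k")
    case True
    show ?thesis
      using column_words_common_subseq_gain[OF ne(1)[OF that that], of "ix k" N'
          "\<lambda>i. q (2 * (a + k)) (k * N' + i)" "\<lambda>i. q (Suc (2 * (a + k))) (k * N' + i)"]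
        ix[OF True] q(2,3)[OF True] True
      by (auto simp: bl_def f_def N_def)
  next
    case False
    show ?thesis
      using column_words_common_subseq[OF ne(1)[OF that that], of N'
          "\<lambda>i. q (2 * (a + k)) (k * N' + i)" "\<lambda>i. q (Suc (2 * (a + k))) (k * N' + i)"] False
      by (auto simp: bl_def f_def N_def)
  qed
  then obtain c where c: "\<And>k. k < K \<Longrightarrow> subseq (c k) (bl (q (2 * (a + k))) k @ bl (q (Suc (2 * (a + k)))) k)"
      "\<And>k. k < K \<Longrightarrow> subseq (c k) (replicate (4 * N) (za k) @ replicate (4 * N) (on k) @ replicate (4 * N) (za k))"
      "\<And>k. k < K \<Longrightarrow> length (c k) = 6 * N + 2 - f (a + k) k"
    by metis
  define h where "h = T - Suc (2 * (a + K))"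
  define z where "z = (replicate (2 * N * (2 * a)) (za 0)
      @ concat (map (\<lambda>k. c k @ replicate (2 * N) (za k)) [0..<K])
      @ replicate (2 * N * h) (za k1)) @ replicate E (za k1)"
  have "subseq z (concat (map (\<lambda>e. g (q e)) [0..<T]) @ pad)"
    unfolding z_def pad_def
  proof (rule list_emb_append_mono)
    have "2 * (a + K) < T"
      using a(1) by (simp add: T_def)
    moreover have "subseq (replicate (2 * N) (za k)) (bl (q e) k)" if "k < K" for e k
      using that cbl(1)[of k k "q e"] by (simp add: subseq_replicate_iff)
    ultimately show "subseq (replicate (2 * N * (2 * a)) (za 0)
        @ concat (map (\<lambda>k. c k @ replicate (2 * N) (za k)) [0..<K]) @ replicate (2 * N * h) (za k1))
      (concat (map (\<lambda>e. g (q e)) [0..<T]))"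
      unfolding g_def h_def k1_def
      using K c(1) by (intro subseq_staircase) auto
  qed (simp add: list_emb_prefix)
  moreover have "subseq z y"
  proof -
    have cy: "subseq (c k @ replicate (2 * N) (za k))
        (replicate (4 * N) (za k) @ replicate (4 * N) (on k) @ replicate (6 * N) (za k))" if "k < K" for k
    proof -
      have "replicate (6 * N) (za k) = replicate (4 * N) (za k) @ replicate (2 * N) (za k)"
        by (simp add: replicate_add[symmetric])
      then show ?thesis
        using list_emb_append_mono[OF c(2)[OF that], of "replicate (2 * N) (za k)" "replicate (2 * N) (za k)"]
        by simp
    qed
    have cp: "subseq (c k @ replicate (2 * N) (za k)) (piece k)" if "k < K" for k
    proof (rule subseq_order.trans[OF cy[OF that]])
      show "subseq (replicate (4 * N) (za k) @ replicate (4 * N) (on k) @ replicate (6 * N) (za k)) (piece k)"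
        unfolding piece_def using K by (intro list_emb_append_mono subseq_replicate_mono) auto
    qed
    have c0: "subseq (replicate (2 * N * (2 * a)) (za 0) @ (c 0 @ replicate (2 * N) (za 0))) (piece 0)"
    proof -
      have "4 * N * a + 4 * N \<le> 4 * N * K"
        using a(1) by (metis Suc_leI mult_Suc_right add.commute mult_le_mono2)
      then have "subseq (replicate (2 * N * (2 * a)) (za 0) @ replicate (4 * N) (za 0)) (replicate (4 * N * K) (za 0))"
        unfolding replicate_add[symmetric] by (intro subseq_replicate_mono) (simp add: algebra_simps)
      then have "subseq ((replicate (2 * N * (2 * a)) (za 0) @ replicate (4 * N) (za 0))
          @ (replicate (4 * N) (on 0) @ replicate (6 * N) (za 0))) (piece 0)"
        unfolding piece_def by (intro list_emb_append_mono) auto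
      moreover have "subseq (replicate (2 * N * (2 * a)) (za 0) @ (c 0 @ replicate (2 * N) (za 0)))
          (replicate (2 * N * (2 * a)) (za 0) @ (replicate (4 * N) (za 0) @ replicate (4 * N) (on 0) @ replicate (6 * N) (za 0)))"
        by (intro list_emb_append_mono cy K) auto
      ultimately show ?thesis
        unfolding append_assoc by (meson subseq_order.trans)
    qed
    have "subseq ((replicate (2 * N * (2 * a)) (za 0) @ (c 0 @ replicate (2 * N) (za 0)))
        @ concat (map (\<lambda>k. c k @ replicate (2 * N) (za k)) [Suc 0..<K])) (piece 0 @ concat (map piece [Suc 0..<K]))"
      by (intro list_emb_append_mono c0 subseq_concat_map cp) auto
    then have 1: "subseq (replicate (2 * N * (2 * a)) (za 0)
        @ concat (map (\<lambda>k. c k @ replicate (2 * N) (za k)) [0..<K])) y0"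
      using K by (simp add: y0_def upt_conv_Cons)
    have "h \<le> 4 * K"
      by (simp add: h_def T_def)
    then have "2 * N * h \<le> 2 * N * (4 * K)"
      by (intro mult_left_mono) auto
    then have "2 * N * h + E \<le> t"
      using tlen by (simp only: mult.assoc mult.left_commute[of N])
    then have 2: "subseq (replicate (2 * N * h) (za k1) @ replicate E (za k1)) (replicate t (za k1))"
      unfolding replicate_add[symmetric] by (intro subseq_replicate_mono)
    show ?thesis
      using list_emb_append_mono[OF 1 2] by (simp add: z_def y_def)
  qed
  ultimately have "length z \<le> LCS (concat (map (\<lambda>e. g (q e)) [0..<T]) @ pad) y"
    by (rule LCS_ge)
  then have up: "real (length z) \<le> (1 + \<epsilon>) * real (L0 + E)"
    using hyb[rule_format, of q] q(1) by fastforce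
  have "(\<Sum>k<K. length (c k) + 2 * N) + b = (\<Sum>k<K. length (c k) + 2 * N + f (a + k) k)"
    by (simp add: b_def sum.distrib)
  also have "\<dots> = (\<Sum>k<K. 8 * N + 2)"
    by (intro sum.cong) (auto simp: c(3) f_def)
  also have "\<dots> = K * (8 * N + 2)"
    by simp
  finally have sumc: "(\<Sum>k<K. length (c k) + 2 * N) + b = K * (8 * N + 2)" .
  have "length z = 2 * N * (2 * a) + (\<Sum>k<K. length (c k) + 2 * N) + 2 * N * h + E"
    by (simp add: z_def length_concat interv_sum_list_conv_sum_set_nat atLeast0LessThan comp_def)
  then have lz: "length z + b = 2 * N * (2 * a + h) + K * (8 * N + 2) + E"
    using sumc by (simp add: algebra_simps)
  have "2 * a + h + 1 = 2 * K"
    using a(1) by (simp add: h_def T_def)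
  then have "2 * N * (2 * a + h) + 2 * N = 4 * N * K"
    by (metis add_mult_distrib2 mult.right_neutral mult.assoc mult_2 mult_2_right numeral_Bit0)
  with lz have lz': "length z + b + 2 * N = 12 * N * K + 2 * K + E"
    by (simp add: algebra_simps)
  have L0: "L0 + 2 * N = 12 * N * K + K"
    by (simp add: L0_def T_def Kk1 algebra_simps)
  have "length z + b = L0 + K + E"
    using lz' L0 by simp
  then have gain: "2 * (L0 + E) + K \<le> 2 * length z"
    using b by presburger
  have "L0 + E \<le> 25 * N * K"
  proof -
    have "K \<le> N * K"
      by (simp add: N_def)
    then show ?thesis
      using L0 unfolding E_def mult.assoc by linarith
  qed
  then have "real (L0 + E) \<le> 25 * real N * real K"
    by (metis of_nat_le_iff of_nat_mult of_nat_numeral)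
  then have "\<epsilon> * real (L0 + E) \<le> \<epsilon> * (25 * real N * real K)"
    using \<epsilon> by (intro mult_left_mono) auto
  also have "\<dots> = (50 * \<epsilon> * real N) * real K / 2"
    by simp
  also have "\<dots> < 1 * real K / 2"
    using small K by (intro divide_strict_right_mono mult_strict_right_mono) (auto simp: N_def)
  finally have "2 * real (length z) < 2 * real (L0 + E) + real K"
    using up by (simp add: algebra_simps)
  moreover have "2 * real (L0 + E) + real K \<le> 2 * real (length z)"
    using gain by linarith
  ultimately show False
    by linarith
qed

section \<open>The space lower bound\<close>

text \<open>With \<open>K\<close> about \<open>card \<Sigma> / 2\<close> and \<open>N\<close> about
  \<open>\<eta> / \<epsilon>\<close>, the product \<open>K * N'\<close> has the desired order, while
  the required length \<open>40 * (K * K * N)\<close> is at most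
  \<open>10 * \<eta> * C * n\<close>.\<close>

lemma space_ge_small_eps:
  fixes C \<epsilon> \<eta> :: real
  assumes \<eta>: "0 < \<eta>" "\<eta> \<le> 1 / 60" "10 * \<eta> * C \<le> 1" and \<epsilon>: "0 < \<epsilon>" "2 * \<epsilon> \<le> \<eta>"
    and \<Sigma>: "finite \<Sigma>" "2 \<le> card \<Sigma>" and n: "real (card \<Sigma>) ^ 2 / \<epsilon> \<le> C * real n"
    and A: "makes_passes A \<Sigma> n R" "computes_LCS_approx A \<Sigma> n \<epsilon>" "uses_space A \<Sigma> n s"
    and R: "1 \<le> R" and s: "1 \<le> s"
  shows "\<eta> / 1152 * (real (card \<Sigma>) / \<epsilon> / real R) \<le> real s"
proof -
  define k where "k = card \<Sigma>"
  define K where "K = k div 2"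
  define N where "N = nat \<lfloor>\<eta> / \<epsilon>\<rfloor>"
  define N' where "N' = N - 1"
  have ge2: "2 \<le> \<eta> / \<epsilon>"
    using \<epsilon> by (simp add: field_simps)
  then have fl: "2 \<le> \<lfloor>\<eta> / \<epsilon>\<rfloor>"
    by (simp add: le_floor_iff)
  then have N2: "2 \<le> N"
    unfolding N_def by linarith
  have Nle: "real N \<le> \<eta> / \<epsilon>" and Ngt: "\<eta> / \<epsilon> < real N + 1"
    using fl by (simp_all add: N_def)
  have SN: "Suc N' = N"
    using N2 by (simp add: N'_def)
  have N'4: "\<eta> / \<epsilon> \<le> 4 * real N'"
  proof -
    have "real N = real N' + 1"
      using SN by (metis of_nat_Suc add.commute)
    then show ?thesis
      using N2 Ngt SN by linarith
  qed
  have "2 * K \<le> k" "k \<le> 3 * K" "0 < K"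
    using \<Sigma>(2) unfolding K_def k_def by linarith+
  then have K: "real K \<le> real k / 2" "real k \<le> 3 * real K" "0 < K"
    by linarith+
  have "40 * (real K * real K * real N) \<le> 40 * ((real k / 2) * (real k / 2) * (\<eta> / \<epsilon>))"
    using K Nle by (intro mult_left_mono mult_mono) auto
  also have "\<dots> = 10 * \<eta> * (real k ^ 2 / \<epsilon>)"
    by (simp add: power2_eq_square)
  also have "\<dots> \<le> 10 * \<eta> * (C * real n)"
    using n \<eta> by (intro mult_left_mono) (auto simp: k_def)
  also have "\<dots> = (10 * \<eta> * C) * real n"
    by simp
  also have "\<dots> \<le> 1 * real n"
    using \<eta> by (intro mult_right_mono) auto
  finally have "real (40 * (K * K * N)) \<le> real n"
    by simp
  then have "40 * (K * K * Suc N') \<le> n"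
    unfolding SN of_nat_le_iff .
  moreover have "50 * \<epsilon> * real (Suc N') < 1"
  proof -
    have "\<epsilon> * real N \<le> \<eta>"
      using Nle \<epsilon> by (simp add: field_simps)
    then show ?thesis
      using \<eta> unfolding SN by linarith
  qed
  moreover have "2 * K \<le> card \<Sigma>" "0 < N'"
    using N2 by (simp_all add: K_def k_def N'_def)
  ultimately have "K * N' < 48 * R * Suc s"
    using space_bound_small_eps[OF \<Sigma>(1) _ A \<epsilon>(1) K(3)] by blast
  also have "\<dots> \<le> 48 * R * (2 * s)"
    using s by (intro mult_left_mono) auto
  finally have "real (K * N') \<le> real (48 * R * (2 * s))"
    by (simp only: of_nat_le_iff less_imp_le)
  then have KN: "real K * real N' \<le> 96 * real R * real s"
    by simp
  have "real k * (\<eta> / \<epsilon>) \<le> (3 * real K) * (4 * real N')"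
    using K N'4 \<eta> \<epsilon> by (intro mult_mono) auto
  also have "\<dots> \<le> 12 * (96 * real R * real s)"
    using KN by simp
  finally have "\<eta> * (real k / \<epsilon>) \<le> 1152 * real s * real R"
    by (simp add: mult.commute)
  then show ?thesis
    using R \<epsilon> by (simp add: k_def field_simps)
qed

text \<open>There are \<open>M\<close> groups of \<open>W\<close> letters, with \<open>W\<close> of
  order \<open>\<epsilon>\<close>. The factor \<open>2 * \<kappa>\<close> in \<open>\<mu>\<close>
  keeps \<open>M * W\<close> at most half the alphabet, and the factor \<open>1 + C\<close> takes
  care of the required length.\<close>

lemma space_ge_large_eps:
  fixes C \<epsilon> \<eta> \<kappa> \<mu> :: real
  assumes C: "0 < C" and \<eta>: "0 < \<eta>" and \<epsilon>: "\<eta> < 2 * \<epsilon>"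
    and \<kappa>: "\<kappa> = 10 / \<eta> + 4" and \<mu>: "\<mu> = 2 * \<kappa> * (1 + C)"
    and \<Sigma>: "finite \<Sigma>" "2 \<le> card \<Sigma>" and n: "real (card \<Sigma>) ^ 2 / \<epsilon> \<le> C * real n"
    and A: "makes_passes A \<Sigma> n R" "computes_LCS_approx A \<Sigma> n \<epsilon>" "uses_space A \<Sigma> n s"
    and R: "1 \<le> R" and s: "1 \<le> s"
  shows "1 / (48 * \<mu>) * (real (card \<Sigma>) / \<epsilon> / real R) \<le> real s"
proof -
  define k where "k = card \<Sigma>"
  have \<epsilon>0: "0 < \<epsilon>"
    using \<eta> \<epsilon> by linarith
  have \<kappa>4: "4 \<le> \<kappa>"
    using \<eta> by (simp add: \<kappa>)
  have "2 * \<kappa> * 1 \<le> \<mu>"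
    unfolding \<mu> using \<kappa>4 C by (intro mult_left_mono) auto
  then have \<mu>\<kappa>: "2 * \<kappa> \<le> \<mu>" and \<mu>0: "0 < \<mu>"
    using \<kappa>4 by auto
  define M where "M = nat \<lfloor>real k / (\<mu> * \<epsilon>)\<rfloor>"
  have frac0: "0 \<le> real k / (\<mu> * \<epsilon>)"
    using \<mu>0 \<epsilon>0 by simp
  have Mle: "real M \<le> real k / (\<mu> * \<epsilon>)" and Mgt: "real k / (\<mu> * \<epsilon>) < real M + 1"
    using frac0 by (simp_all add: M_def)
  show ?thesis
  proof (cases "M = 0")
    \<comment> \<open>If \<open>M\<close> rounds down to 0, then
      \<open>k / \<epsilon> \<le> \<mu>\<close>, and \<open>1 \<le> s\<close> suffices.\<close>
    case True
    then have "real k / (\<mu> * \<epsilon>) \<le> 1"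
      using Mgt by simp
    then have "real k / \<epsilon> \<le> \<mu>"
      using \<mu>0 \<epsilon>0 by (simp add: field_simps)
    also have "\<dots> \<le> 48 * \<mu> * (real s * real R)"
    proof -
      have "1 * 1 \<le> real s * real R"
        using R s by (intro mult_mono) auto
      then have "\<mu> * 1 \<le> \<mu> * (48 * (real s * real R))"
        using \<mu>0 by (intro mult_left_mono) auto
      then show ?thesis
        by simp
    qed
    finally show ?thesis
      using R \<epsilon>0 \<mu>0 by (simp add: k_def field_simps)
  next
    case False
    then have M0: "0 < M"
      by simp
    \<comment> \<open>The least integer above \<open>4 * (1 + \<epsilon>)\<close>; the lower bound
      on \<open>\<epsilon>\<close> absorbs the constant \<open>5\<close> into
      \<open>\<kappa> * \<epsilon>\<close>.\<close>
    define W where "W = nat \<lfloor>4 * (1 + \<epsilon>)\<rfloor> + 1"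
    have Wgt: "4 * (1 + \<epsilon>) < real W" and Wle: "real W \<le> 5 + 4 * \<epsilon>"
      using \<epsilon>0 by (simp_all add: W_def) linarith+
    have "5 \<le> 10 / \<eta> * \<epsilon>"
      using \<epsilon> \<eta> by (simp add: field_simps)
    then have W\<kappa>: "real W \<le> \<kappa> * \<epsilon>"
      using Wle by (simp add: \<kappa> algebra_simps)
    have "real M * real W \<le> real k / (\<mu> * \<epsilon>) * (\<kappa> * \<epsilon>)"
      using Mle W\<kappa> frac0 by (intro mult_mono) auto
    also have "\<dots> = real k * (\<kappa> / \<mu>)"
      using \<epsilon>0 by simp
    also have "\<dots> \<le> real k * (1 / 2)"
      using \<mu>\<kappa> \<mu>0 by (intro mult_left_mono) (auto simp: field_simps)
    finally have MW: "real M * real W \<le> real k * (\<kappa> / \<mu>)" "real M * real W \<le> real k / 2"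
      using \<open>real M * real W \<le> real k / (\<mu> * \<epsilon>) * (\<kappa> * \<epsilon>)\<close> \<epsilon>0 by auto
    have "real (M * W + 1) \<le> real k"
      using MW(2) \<Sigma>(2) by (simp add: k_def)
    then have card: "M * W + 1 \<le> card \<Sigma>"
      unfolding k_def of_nat_le_iff .
    have "2 * (real M * real W) * real M \<le> 2 * (real k * (\<kappa> / \<mu>)) * (real k / (\<mu> * \<epsilon>))"
      using MW(1) Mle \<kappa>4 \<mu>0 by (intro mult_mono[of "2 * (real M * real W)"]) (auto intro!: mult_nonneg_nonneg)
    also have "\<dots> = (2 * \<kappa> / (\<mu> * \<mu>)) * (real k ^ 2 / \<epsilon>)"
      by (simp add: power2_eq_square mult_ac)
    also have "\<dots> \<le> (2 * \<kappa> / (\<mu> * \<mu>)) * (C * real n)"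
      using n \<kappa>4 by (intro mult_left_mono) (auto simp: k_def)
    also have "\<dots> = (2 * \<kappa> * C) / (\<mu> * \<mu>) * real n"
      by simp
    also have "\<dots> \<le> 1 * real n"
    proof (rule mult_right_mono)
      have "2 * \<kappa> * C \<le> \<mu>"
        unfolding \<mu> using \<kappa>4 by (intro mult_left_mono) auto
      also have "\<dots> \<le> \<mu> * \<mu>"
        using \<mu>\<kappa> \<kappa>4 by (simp add: mult_le_cancel_left1)
      finally show "(2 * \<kappa> * C) / (\<mu> * \<mu>) \<le> 1"
        using \<mu>0 by (simp add: divide_le_eq)
    qed simp
    finally have "real (2 * (M * W) * M) \<le> real n"
      by simp
    then have "2 * (M * W) * M \<le> n"
      unfolding of_nat_le_iff .
    then have "M < 12 * R * Suc s"
      using space_bound_large_eps[OF \<Sigma>(1) card A \<epsilon>0 M0 Wgt] by blast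
    also have "\<dots> \<le> 12 * R * (2 * s)"
      using s by (intro mult_left_mono) auto
    finally have "real M \<le> real (12 * R * (2 * s))"
      by (simp only: of_nat_le_iff less_imp_le)
    then have "real M \<le> 24 * real R * real s"
      by simp
    moreover have "real k / (\<mu> * \<epsilon>) \<le> 2 * real M"
      using Mgt M0 by linarith
    ultimately have "real k / (\<mu> * \<epsilon>) \<le> 48 * real R * real s"
      by linarith
    then show ?thesis
      using R \<epsilon>0 \<mu>0 by (simp add: k_def field_simps)
  qed
qed

text \<open>\<open>C\<close> is the constant hidden in \<open>O(n)\<close>, and \<open>c\<close> is
  computed from \<open>C\<close> alone. The two constructions are separated at
  \<open>\<epsilon> = \<eta> / 2\<close>.\<close>

theorem theorem1p5:
  fixes C :: real
  assumes "C > 0"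
  shows "\<exists>c::real. c > 0 \<and>
    (\<forall>(\<Sigma> :: 'a set) (n :: nat) (\<epsilon> :: real) (R :: nat) (A :: 'a asym_alg) (s :: nat).
       finite \<Sigma> \<and> card \<Sigma> \<ge> 2 \<and> \<epsilon> > 0 \<and> real (card \<Sigma>) ^ 2 / \<epsilon> \<le> C * real n \<and> R \<ge> 1 \<and>
       makes_passes A \<Sigma> n R \<and> computes_LCS_approx A \<Sigma> n \<epsilon> \<and> uses_space A \<Sigma> n s
       \<longrightarrow> real s \<ge> c * (real (card \<Sigma>) / \<epsilon> / real R))"
proof -
  \<comment> \<open>The bound \<open>1 / 60\<close> ensures \<open>50 * \<eta> < 1\<close>; the
    bound \<open>1 / (10 * C)\<close> makes the inputs for small \<open>\<epsilon>\<close> fit into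
    length \<open>n\<close>.\<close>
  define \<eta> where "\<eta> = min (1 / 60) (1 / (10 * C))"
  define \<kappa> where "\<kappa> = 10 / \<eta> + 4"
  define \<mu> where "\<mu> = 2 * \<kappa> * (1 + C)"
  define c where "c = min (\<eta> / 1152) (1 / (48 * \<mu>))"
  have \<eta>: "0 < \<eta>" "\<eta> \<le> 1 / 60"
    using assms by (auto simp: \<eta>_def)
  have "\<eta> \<le> 1 / (10 * C)"
    by (simp add: \<eta>_def)
  then have \<eta>C: "10 * \<eta> * C \<le> 1"
    using assms by (simp add: field_simps)
  have "0 < \<kappa>"
    using \<eta> by (simp add: \<kappa>_def add_pos_pos)
  then have \<mu>: "0 < \<mu>"
    using assms by (simp add: \<mu>_def)
  have "c * (real (card \<Sigma>) / \<epsilon> / real R) \<le> real s"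
    if \<Sigma>: "finite \<Sigma>" "2 \<le> card \<Sigma>" and \<epsilon>: "0 < \<epsilon>" and n: "real (card \<Sigma>) ^ 2 / \<epsilon> \<le> C * real n"
      and R: "1 \<le> R"
      and A: "makes_passes A \<Sigma> n R" "computes_LCS_approx A \<Sigma> n \<epsilon>" "uses_space A \<Sigma> n s"
    for \<Sigma> :: "'a set" and n \<epsilon> R A s
  proof -
    have "0 < real (card \<Sigma>) ^ 2 / \<epsilon>"
      using \<Sigma>(2) \<epsilon> by simp
    then have "0 < n"
      using n by (cases n) auto
    then have s: "1 \<le> s"
      using uses_space_pos[OF \<Sigma> _ A(2,3)] by blast
    have r: "0 \<le> real (card \<Sigma>) / \<epsilon> / real R"
      using \<epsilon> by simp
    show ?thesis
    proof (cases "2 * \<epsilon> \<le> \<eta>")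
      case True
      have "c * (real (card \<Sigma>) / \<epsilon> / real R) \<le> \<eta> / 1152 * (real (card \<Sigma>) / \<epsilon> / real R)"
        using r by (intro mult_right_mono) (simp_all add: c_def)
      also have "\<dots> \<le> real s"
        by (rule space_ge_small_eps[OF \<eta> \<eta>C \<epsilon> True \<Sigma> n A R s])
      finally show ?thesis .
    next
      case False
      have "c * (real (card \<Sigma>) / \<epsilon> / real R) \<le> 1 / (48 * \<mu>) * (real (card \<Sigma>) / \<epsilon> / real R)"
        using r by (intro mult_right_mono) (simp_all add: c_def)
      also have "\<dots> \<le> real s"
        by (rule space_ge_large_eps[OF assms \<eta>(1) _ \<kappa>_def \<mu>_def \<Sigma> n A R s]) (use False in simp)
      finally show ?thesis .
    qed
  qed
  moreover have "0 < c"
    using \<eta> \<mu> by (simp add: c_def)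
  ultimately show ?thesis
    by (intro exI[of _ c]) blast
qed

end
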